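(* Let $\alpha<1$, $f\in\mathfrak{A}_\alpha$, and let $\{\phi_t\}_{t\ge0}$ be the semigroup generated by $f$. Then (i) this semigroup has no repelling fixed points; (ii) this semigroup is exponentially squeezing with squeezing ratio $\varkappa(\alpha)$; (iii) this semigroup extends analytically to the sector $\Lambda\left(\frac{\pi(1-\delta(\alpha))}{2}\right)$, where $\delta(\alpha)\le b(\alpha)$.
   Context: Let $\mathbb{D}$ be the open unit disk. $\mathcal{A}$ is the set of holomorphic $f:\mathbb{D}\to\mathbb{C}$ with $f(0)=0$, $f'(0)=1$. For $\alpha\le1$, $$\mathfrak{A}_\alpha=\left\{f\in\mathcal{A}:\ \operatorname{Re}\left[\alpha\frac{f(z)}{z}+(1-\alpha)f'(z)\right]\ge0,\ z\in\mathbb{D}\setminus\{0\}\right\}.$$ Every $f\in\mathfrak{A}_\alpha$ satisfies $\operatorname{Re}(f(z)/z)>0$, and therefore generates a semigroup of holomorphic self-maps of $\mathbb{D}$: $\phi_t(z)$, $t\ge0$, is the solution of $\frac{\partial\phi_t(z)}{\partial t}+f(\phi_t(z))=0$, $\phi_0(z)=z\in\mathbb{D}$. A point $\zeta\in\partial\mathbb{D}$ is a repelling fixed point of $\{\phi_t\}_{t\ge0}$ if for some (hence all) $t>0$ the angular derivative $\phi_t'(\zeta)=\angle\lim_{z\to\zeta}\frac{\phi_t(z)-\zeta}{z-\zeta}$ exists finitely. The semigroup is exponentially squeezing with squeezing ratio $a>0$ if $|\phi_t(z)|\le e^{-at}|z|$ for all $z\in\mathbb{D}$, $t\ge0$. For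 $\theta\in(0,\pi/2]$, $\Lambda(\theta)=\{\zeta\in\mathbb{C}:|\arg\zeta|<\theta\}$. The semigroup extends analytically to $\Lambda(\theta)$ if there is a family $\{\Phi_\zeta\}_{\zeta\in\Lambda(\theta)\cup\{0\}}$ of holomorphic self-maps of $\mathbb{D}$ with $\zeta\mapsto\Phi_\zeta$ analytic in $\Lambda(\theta)$, $\lim_{\zeta\to0}\Phi_\zeta=\Phi_0=\mathrm{Id}$, $\Phi_{\zeta_1+\zeta_2}=\Phi_{\zeta_1}\circ\Phi_{\zeta_2}$ for all $\zeta_1,\zeta_2\in\Lambda(\theta)\cup\{0\}$, and $\Phi_t=\phi_t$ for $t\ge0$. For $\alpha<1$ put $F_\alpha(z)=\int_0^1\frac{1+t^{1-\alpha}z}{1-t^{1-\alpha}z}\,dt$ (also for $|z|=1$, $z\ne1$), $$\varkappa(\alpha)=\int_0^1\frac{1-t^{1-\alpha}}{1+t^{1-\alpha}}\,dt,\qquad \delta(\alpha)=\frac2\pi\max_{0<\theta<\pi}\arg F_\alpha(e^{i\theta}),$$ and let $b(\alpha)$ be the unique solution $b\in[0,1]$ of $\frac{\pi b}{2}+\arctan((1-\alpha)b)=\frac\pi2$. *)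

theory Defs
  imports "HOL-Complex_Analysis.Complex_Analysis"
begin

abbreviation unit_disk :: "complex set" ("\<bbbD>")
  where "\<bbbD> \<equiv> ball 0 1"

definition normalized_holomorphic :: "(complex \<Rightarrow> complex) set" ("\<A>")
  where "\<A> = {f. f holomorphic_on \<bbbD> \<and> f 0 = 0 \<and> deriv f 0 = 1}"

definition filtration_class :: "real \<Rightarrow> (complex \<Rightarrow> complex) set" ("\<AA>")
  where "\<AA> \<alpha> = {f \<in> \<A>. \<forall>z \<in> \<bbbD> - {0}.
           Re (of_real \<alpha> * (f z / z) + of_real (1 - \<alpha>) * deriv f z) \<ge> 0}"

(* The family is given by the Cauchy problem alone. Holomorphy of each phi t and
   the semigroup law are consequences, so they are not assumed here. *)
definition semigroup_generated_by ::
    "(complex \<Rightarrow> complex) \<Rightarrow> (real \<Rightarrow> complex \<Rightarrow> complex) \<Rightarrow> bool"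
  where "semigroup_generated_by f \<phi> \<longleftrightarrow>
    (\<forall>z \<in> \<bbbD>. \<phi> 0 z = z \<and>
      (\<forall>t \<ge> 0. \<phi> t z \<in> \<bbbD> \<and>
        ((\<lambda>s. \<phi> s z) has_vector_derivative - f (\<phi> t z)) (at t within {0..})))"

definition stolz_region :: "complex \<Rightarrow> real \<Rightarrow> complex set"
  where "stolz_region \<zeta> M = {z \<in> \<bbbD>. norm (z - \<zeta>) < M * (1 - norm z)}"

definition has_angular_limit ::
    "(complex \<Rightarrow> complex) \<Rightarrow> complex \<Rightarrow> complex \<Rightarrow> bool"
  where "has_angular_limit g L \<zeta> \<longleftrightarrow>
    (\<forall>M > 1. (g \<longlongrightarrow> L) (at \<zeta> within stolz_region \<zeta> M))"

definition has_angular_derivative ::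
    "(complex \<Rightarrow> complex) \<Rightarrow> complex \<Rightarrow> complex \<Rightarrow> bool"
  where "has_angular_derivative g L \<zeta> \<longleftrightarrow>
    has_angular_limit (\<lambda>z. (g z - \<zeta>) / (z - \<zeta>)) L \<zeta>"

definition repelling_fixed_point :: "(real \<Rightarrow> complex \<Rightarrow> complex) \<Rightarrow> complex \<Rightarrow> bool"
  where "repelling_fixed_point \<phi> \<zeta> \<longleftrightarrow>
    norm \<zeta> = 1 \<and> (\<exists>t > 0. \<exists>L. has_angular_derivative (\<phi> t) L \<zeta>)"

definition exponentially_squeezing ::
    "(real \<Rightarrow> complex \<Rightarrow> complex) \<Rightarrow> real \<Rightarrow> bool"
  where "exponentially_squeezing \<phi> a \<longleftrightarrow>
    a > 0 \<and> (\<forall>z \<in> \<bbbD>. \<forall>t \<ge> 0. norm (\<phi> t z) \<le> exp (- a * t) * norm z)"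

(* The origin is excluded explicitly because Arg 0 = 0. *)
definition sector :: "real \<Rightarrow> complex set" ("\<Lambda>")
  where "\<Lambda> \<theta> = {\<zeta>. \<zeta> \<noteq> 0 \<and> \<bar>Arg \<zeta>\<bar> < \<theta>}"

(* Analyticity in zeta and the limit at 0 refer to the space of holomorphic functions on
   the disk with the topology of uniform convergence on compact subsets: Psi zeta is the
   complex derivative of zeta |-> Phi zeta in that space. *)
definition extends_analytically ::
    "(real \<Rightarrow> complex \<Rightarrow> complex) \<Rightarrow> real \<Rightarrow> bool"
  where "extends_analytically \<phi> \<theta> \<longleftrightarrow>
    0 < \<theta> \<and> \<theta> \<le> pi / 2 \<and>
    (\<exists>\<Phi> :: complex \<Rightarrow> complex \<Rightarrow> complex.
       (\<forall>\<zeta> \<in> \<Lambda> \<theta> \<union> {0}. \<Phi> \<zeta> holomorphic_on \<bbbD> \<and> \<Phi> \<zeta> ` \<bbbD> \<subseteq> \<bbbD>) \<and>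
       (\<exists>\<Psi> :: complex \<Rightarrow> complex \<Rightarrow> complex. \<forall>\<zeta> \<in> \<Lambda> \<theta>. \<forall>K. compact K \<and> K \<subseteq> \<bbbD> \<longrightarrow>
          uniform_limit K (\<lambda>\<xi> z. (\<Phi> \<xi> z - \<Phi> \<zeta> z) / (\<xi> - \<zeta>)) (\<Psi> \<zeta>) (at \<zeta>)) \<and>
       (\<forall>K. compact K \<and> K \<subseteq> \<bbbD> \<longrightarrow> uniform_limit K \<Phi> (\<Phi> 0) (at 0 within \<Lambda> \<theta>)) \<and>
       (\<forall>z \<in> \<bbbD>. \<Phi> 0 z = z) \<and>
       (\<forall>\<zeta>\<^sub>1 \<in> \<Lambda> \<theta> \<union> {0}. \<forall>\<zeta>\<^sub>2 \<in> \<Lambda> \<theta> \<union> {0}. \<forall>z \<in> \<bbbD>.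
          \<Phi> (\<zeta>\<^sub>1 + \<zeta>\<^sub>2) z = \<Phi> \<zeta>\<^sub>1 (\<Phi> \<zeta>\<^sub>2 z)) \<and>
       (\<forall>t \<ge> 0. \<forall>z \<in> \<bbbD>. \<Phi> (of_real t) z = \<phi> t z))"

definition F :: "real \<Rightarrow> complex \<Rightarrow> complex"
  where "F \<alpha> z = integral {0..1}
    (\<lambda>t::real. (1 + of_real (t powr (1 - \<alpha>)) * z) / (1 - of_real (t powr (1 - \<alpha>)) * z))"

definition squeezing_const :: "real \<Rightarrow> real" ("\<kappa>")
  where "\<kappa> \<alpha> = integral {0..1} (\<lambda>t::real. (1 - t powr (1 - \<alpha>)) / (1 + t powr (1 - \<alpha>)))"

(* GREATEST denotes an attained maximum; the library's Max only covers finite sets. *)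
definition sector_const :: "real \<Rightarrow> real" ("\<delta>")
  where "\<delta> \<alpha> = 2 / pi *
    (GREATEST x. x \<in> (\<lambda>\<theta>. Arg (F \<alpha> (cis \<theta>))) ` {0<..<pi})"

definition sector_bound :: "real \<Rightarrow> real" ("\<b>")
  where "\<b> \<alpha> = (THE b. 0 \<le> b \<and> b \<le> 1 \<and> pi * b / 2 + arctan ((1 - \<alpha>) * b) = pi / 2)"

end

theory Submission imports Defs begin

text \<open>
Write \<open>f z = z * p z\<close> and \<open>q z = p z + (1 - \<alpha>) * z * p' z\<close>, so that \<open>Re q \<ge> 0\<close>. Integrating
\<open>d/dt (t * p (t powr (1 - \<alpha>) * z))\<close> gives \<open>p z\<close> as the mean of \<open>q (t powr (1 - \<alpha>) * z)\<close> over
\<open>t \<in> {0..1}\<close>, and the Schwarz integral formula for \<open>q\<close> turns this into an average of rotations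
\<open>F \<alpha> (x * z)\<close>, \<open>norm x = 1\<close>, with nonnegative weights. Hence every closed half-plane that contains
\<open>F \<alpha> ` \<bbbD>\<close> contains \<open>p ` \<bbbD>\<close>. This gives \<open>Re p \<ge> \<kappa> \<alpha>\<close>, thus the squeezing, which in turn keeps
\<open>\<phi> t\<close> away from the unit circle and excludes repelling fixed points. It also gives
\<open>\<bar>Arg p\<bar> \<le> pi * \<delta> \<alpha> / 2\<close>; under this bound \<open>\<zeta> * f\<close> still points inwards for all \<open>\<zeta>\<close> in the
sector, so with the linearizing function \<open>h\<close> (\<open>h' * f = h\<close>, \<open>h \<circ> \<phi> t = exp (- t) * h\<close>) the
extension is \<open>z \<mapsto> h\<^sup>-\<^sup>1 (exp (- \<zeta>) * h z)\<close>. The inequality \<open>\<delta> \<alpha> \<le> \<b> \<alpha>\<close> comes from a boundary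
Schwarz lemma for \<open>Ln (F \<alpha> z)\<close> at a point of the circle where \<open>Arg (F \<alpha> z)\<close> is maximal, combined
with \<open>F \<alpha> z + (1 - \<alpha>) * z * (F \<alpha>)' z = (1 + z) / (1 - z)\<close>.
\<close>

section \<open>The function F on the slit plane\<close>

definition cayley :: "complex \<Rightarrow> complex"
  where "cayley w = (1 + w) / (1 - w)"

text \<open>The plane without the ray [1, \<infinity>). For \<alpha> < 1 the poles of the integrands
  of \<open>F \<alpha>\<close> fill exactly that ray as t varies, so \<open>F \<alpha>\<close> is
  holomorphic across the unit circle away from 1, where the extremal argument will be
  differentiated.\<close>

definition slit_plane :: "complex set"
  where "slit_plane = {z. 1 - z \<notin> \<real>\<^sub>\<le>\<^sub>0}"

lemma F_eq_integral_cayley: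
  "F \<alpha> z = integral {0..1} (\<lambda>t. cayley (of_real (t powr (1 - \<alpha>)) * z))"
  by (simp add: F_def cayley_def)

lemma open_slit_plane: "open slit_plane"
proof -
  have "open ((\<lambda>z. 1 - z) -` (- (\<real>\<^sub>\<le>\<^sub>0 :: complex set)))"
    by (intro open_vimage continuous_intros) auto
  then show ?thesis by (simp add: slit_plane_def vimage_def)
qed

lemma slit_plane_scaled_ne_1:
  assumes "z \<in> slit_plane" "s \<in> {0..1}"
  shows "of_real s * z \<noteq> 1"
proof
  assume *: "of_real s * z = 1"
  then have "s > 0" using assms by (cases "s = 0") auto
  then have "z = of_real (1 / s)" using * by (simp add: field_simps)
  then have "1 - z = of_real (1 - 1 / s)" by simp
  moreover have "1 - 1 / s \<le> 0" using \<open>s > 0\<close> assms by (simp add: field_simps)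
  ultimately have "1 - z \<in> \<real>\<^sub>\<le>\<^sub>0" by (metis nonpos_Reals_of_real_iff)
  with assms show False by (simp add: slit_plane_def)
qed

lemma cball_subset_slit_plane:
  assumes "norm z \<le> 1" "z \<noteq> 1"
  shows "z \<in> slit_plane"
proof -
  have "1 - z \<notin> \<real>\<^sub>\<le>\<^sub>0"
  proof
    assume "1 - z \<in> \<real>\<^sub>\<le>\<^sub>0"
    then have "Re z \<ge> 1" "Im z = 0" by (auto simp: complex_nonpos_Reals_iff)
    moreover have "Re z \<le> 1" using complex_Re_le_cmod[of z] assms by simp
    ultimately show False using assms by (auto simp: complex_eq_iff)
  qed
  then show ?thesis by (simp add: slit_plane_def)
qed

lemma disk_subset_slit_plane: "\<bbbD> \<subseteq> slit_plane"
proof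
  fix z :: complex assume "z \<in> \<bbbD>"
  then show "z \<in> slit_plane" by (intro cball_subset_slit_plane) auto
qed

lemma cis_in_slit_plane: "0 < \<theta> \<Longrightarrow> \<theta> < 2 * pi \<Longrightarrow> cis \<theta> \<in> slit_plane"
proof (rule cball_subset_slit_plane)
  assume *: "0 < \<theta>" "\<theta> < 2 * pi"
  show "cis \<theta> \<noteq> 1"
  proof
    assume "cis \<theta> = 1"
    then have "cos (2 * (\<theta> / 2)) = 1" by (simp add: complex_eq_iff)
    then have "sin (\<theta> / 2) = 0" unfolding cos_double_sin by simp
    moreover have "sin (\<theta> / 2) > 0" using * by (intro sin_gt_zero) auto
    ultimately show False by simp
  qed
qed auto

lemma powr_in_unit_interval: "\<alpha> < 1 \<Longrightarrow> t \<in> {0..1} \<Longrightarrow> t powr (1 - \<alpha>) \<in> {0..1::real}"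
  using powr_le1[of "1 - \<alpha>" t] by auto

lemma continuous_on_powr_unit:
  "\<alpha> < 1 \<Longrightarrow> continuous_on {0..1} (\<lambda>t::real. t powr (1 - \<alpha>))"
  by (intro continuous_on_powr' continuous_intros) auto

lemma continuous_on_cayley_powr:
  assumes "\<alpha> < 1" "z \<in> slit_plane"
  shows "continuous_on {0..1} (\<lambda>t. cayley (of_real (t powr (1 - \<alpha>)) * z))"
  unfolding cayley_def
  using slit_plane_scaled_ne_1[OF assms(2) powr_in_unit_interval[OF assms(1)]] assms
  by (intro continuous_intros continuous_on_powr_unit) auto

lemma has_field_derivative_cayley:
  "w \<noteq> 1 \<Longrightarrow> (cayley has_field_derivative 2 / (1 - w)\<^sup>2) (at w within S)"
  unfolding cayley_def by (auto intro!: derivative_eq_intros simp: field_simps power2_eq_square)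

text \<open>The exact derivative behind the operator g + b z g': integrated over [0, 1] it leaves
  only \<open>g z\<close>. It is applied with \<open>b = 1 - \<alpha>\<close> to
  \<open>cayley\<close> and to the factor \<open>p\<close> of \<open>f\<close>.\<close>

lemma has_vector_derivative_mult_powr:
  fixes g :: "complex \<Rightarrow> complex"
  assumes "(g has_field_derivative g') (at (of_real (t powr b) * z))" "t > 0"
  shows "((\<lambda>t. of_real t * g (of_real (t powr b) * z)) has_vector_derivative
           (g (of_real (t powr b) * z) + of_real b * (of_real (t powr b) * z * g'))) (at t)"
proof -
  have "((\<lambda>t. of_real (t powr b) * z) has_vector_derivative of_real (b * t powr (b - 1)) * z) (at t)"
    using assms(2)
    by (auto intro!: derivative_eq_intros has_vector_derivative_of_real
        simp: has_real_derivative_iff_has_vector_derivative[symmetric])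
  from field_vector_diff_chain_at[OF this assms(1)]
  have *: "((\<lambda>t. g (of_real (t powr b) * z)) has_vector_derivative
          of_real (b * t powr (b - 1)) * z * g') (at t)"
    by (simp add: o_def)
  have "((\<lambda>t. complex_of_real t) has_vector_derivative 1) (at t)"
    using has_vector_derivative_of_real[OF DERIV_ident] by simp
  from has_vector_derivative_mult[OF this *]
  have der: "((\<lambda>t. of_real t * g (of_real (t powr b) * z)) has_vector_derivative
       (of_real t * (of_real (b * t powr (b - 1)) * z * g') + 1 * g (of_real (t powr b) * z))) (at t)" .
  have "t * (b * t powr (b - 1)) = b * t powr b"
    using assms(2) by (simp add: powr_diff)
  then have "complex_of_real t * of_real (b * t powr (b - 1)) = of_real b * of_real (t powr b)"
    by (metis of_real_mult)
  then have eq: "of_real t * (of_real (b * t powr (b - 1)) * z * g') = of_real b * (of_real (t powr b) * z * g')"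
    by (simp only: mult.assoc[symmetric])
  from der show ?thesis
    unfolding eq mult_1_left by (subst add.commute)
qed

lemma F_has_field_derivative:
  assumes "\<alpha> < 1" "z \<in> slit_plane"
  shows "(F \<alpha> has_field_derivative (integral {0..1} (\<lambda>t. of_real (t powr (1 - \<alpha>)) * (2 / (1 - of_real (t powr (1 - \<alpha>)) * z)\<^sup>2)))) (at z)"
proof -
  obtain e where e: "e > 0" "ball z e \<subseteq> slit_plane"
    using open_slit_plane assms(2) openE by blast
  let ?fx = "\<lambda>z t. of_real (t powr (1 - \<alpha>)) * (2 / (1 - of_real (t powr (1 - \<alpha>)) * z)\<^sup>2)"
  have "((\<lambda>z. integral (cbox 0 1) (\<lambda>t. cayley (of_real (t powr (1 - \<alpha>)) * z))) has_field_derivative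
     integral (cbox 0 1) (?fx z)) (at z within ball z e)"
  proof (rule leibniz_rule_field_derivative)
    fix x and t :: real assume x: "x \<in> ball z e" and t: "t \<in> cbox 0 1"
    then have ne: "of_real (t powr (1 - \<alpha>)) * x \<noteq> 1"
      using slit_plane_scaled_ne_1[of x "t powr (1 - \<alpha>)"] powr_in_unit_interval[OF assms(1), of t] e by auto
    have "((\<lambda>x. of_real (t powr (1 - \<alpha>)) * x) has_field_derivative of_real (t powr (1 - \<alpha>))) (at x within ball z e)"
      by (auto intro!: derivative_eq_intros)
    from DERIV_chain2[OF has_field_derivative_cayley[OF ne] this]
    show "((\<lambda>x. cayley (of_real (t powr (1 - \<alpha>)) * x)) has_field_derivative ?fx x t) (at x within ball z e)"
      by (simp add: mult.commute)
  next
    fix x assume x: "x \<in> ball z e"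
    show "(\<lambda>t. cayley (of_real (t powr (1 - \<alpha>)) * x)) integrable_on cbox 0 1"
      using continuous_on_cayley_powr[OF assms(1)] x e
      by (intro integrable_continuous) auto
  next
    have c: "continuous_on (ball z e \<times> cbox 0 1) (\<lambda>x. snd x powr (1 - \<alpha>))"
      using assms(1) by (intro continuous_on_powr' continuous_intros) auto
    have "1 - of_real (t powr (1 - \<alpha>)) * x \<noteq> 0" if "x \<in> ball z e" "t \<in> cbox 0 1" for x t
      using slit_plane_scaled_ne_1[of x "t powr (1 - \<alpha>)"] powr_in_unit_interval[OF assms(1), of t] e that by auto
    then show "continuous_on (ball z e \<times> cbox 0 1) (\<lambda>(x, t). ?fx x t)"
      unfolding case_prod_unfold
      by (intro continuous_intros c) auto
  qed (use e in auto)
  then show ?thesis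
    using e by (simp add: F_eq_integral_cayley[abs_def] at_within_open[of _ "ball z e"])
qed

lemma F_holomorphic: "\<alpha> < 1 \<Longrightarrow> F \<alpha> holomorphic_on slit_plane"
  using F_has_field_derivative by (auto simp: holomorphic_on_open open_slit_plane)

lemma F_has_integral:
  assumes "\<alpha> < 1" "z \<in> slit_plane"
  shows "((\<lambda>t. cayley (of_real (t powr (1 - \<alpha>)) * z)) has_integral F \<alpha> z) {0..1}"
  unfolding F_eq_integral_cayley
  using continuous_on_cayley_powr[OF assms] by (intro integrable_integral integrable_continuous_interval)

text \<open>The left side is the integral of the derivative of
  \<open>t * cayley (t powr (1 - \<alpha>) * z)\<close>, which over [0, 1] gives the end value
  \<open>cayley z\<close>. Thus \<open>F \<alpha>\<close> is the case in which \<open>q\<close> is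
  the Cayley function itself.\<close>

lemma F_differential_equation:
  assumes "\<alpha> < 1" "z \<in> slit_plane"
  shows "F \<alpha> z + of_real (1 - \<alpha>) * (z * deriv (F \<alpha>) z) = cayley z"
proof -
  let ?s = "\<lambda>t. complex_of_real (t powr (1 - \<alpha>))"
  have ne: "?s t * z \<noteq> 1" if "t \<in> {0..1}" for t
    using slit_plane_scaled_ne_1[OF assms(2) powr_in_unit_interval[OF assms(1) that]] .
  have "((\<lambda>t. cayley (?s t * z) + of_real (1 - \<alpha>) * (?s t * z * (2 / (1 - ?s t * z)\<^sup>2))) has_integral
      (of_real 1 * cayley (?s 1 * z) - of_real 0 * cayley (?s 0 * z))) {0..1}"
  \<comment> \<open>The interior form is used because \<open>t powr (1 - \<alpha>)\<close> need not
    be differentiable at 0.\<close>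
  proof (rule fundamental_theorem_of_calculus_interior)
    show "continuous_on {0..1} (\<lambda>t. of_real t * cayley (?s t * z))"
      by (intro continuous_intros continuous_on_cayley_powr assms)
    show "((\<lambda>t. of_real t * cayley (?s t * z)) has_vector_derivative
        cayley (?s t * z) + of_real (1 - \<alpha>) * (?s t * z * (2 / (1 - ?s t * z)\<^sup>2))) (at t)"
      if "t \<in> {0<..<1}" for t
      using that ne[of t] by (intro has_vector_derivative_mult_powr has_field_derivative_cayley) auto
  qed auto
  moreover have "continuous_on {0..1} (\<lambda>t. ?s t * (2 / (1 - ?s t * z)\<^sup>2))"
    using ne by (intro continuous_intros continuous_on_powr_unit assms) auto
  then have "((\<lambda>t. ?s t * (2 / (1 - ?s t * z)\<^sup>2)) has_integral deriv (F \<alpha>) z) {0..1}"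
    unfolding DERIV_imp_deriv[OF F_has_field_derivative[OF assms]]
    by (intro integrable_integral integrable_continuous_interval)
  then have "((\<lambda>t. of_real (1 - \<alpha>) * (z * (?s t * (2 / (1 - ?s t * z)\<^sup>2)))) has_integral
      of_real (1 - \<alpha>) * (z * deriv (F \<alpha>) z)) {0..1}"
    by (intro has_integral_mult_right)
  from has_integral_add[OF F_has_integral[OF assms] this]
  have "((\<lambda>t. cayley (?s t * z) + of_real (1 - \<alpha>) * (?s t * z * (2 / (1 - ?s t * z)\<^sup>2))) has_integral
      F \<alpha> z + of_real (1 - \<alpha>) * (z * deriv (F \<alpha>) z)) {0..1}"
    by (simp add: mult_ac)
  ultimately show ?thesis
    by (auto dest: has_integral_unique)
qed

lemma F_cnj:
  assumes "\<alpha> < 1" "z \<in> slit_plane"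
  shows "F \<alpha> (cnj z) = cnj (F \<alpha> z)"
proof -
  have "((\<lambda>t. cnj (cayley (of_real (t powr (1 - \<alpha>)) * z))) has_integral cnj (F \<alpha> z)) {0..1}"
    using has_integral_cnj[THEN iffD2, OF F_has_integral[OF assms]] by (simp add: o_def)
  then show ?thesis
    by (simp add: F_eq_integral_cayley cayley_def integral_unique)
qed

lemma F_0: "\<alpha> < 1 \<Longrightarrow> F \<alpha> 0 = 1"
  by (simp add: F_eq_integral_cayley cayley_def)

section \<open>Lower bound for the real part of F on the closed disk\<close>

lemma Re_cayley: "Re (cayley w) = (1 - (norm w)\<^sup>2) / (norm (1 - w))\<^sup>2"
  by (simp add: cayley_def Re_divide cmod_power2) (simp add: power2_eq_square algebra_simps)

lemma Im_cayley: "Im (cayley w) = 2 * Im w / (norm (1 - w))\<^sup>2"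
  by (simp add: cayley_def Im_divide cmod_power2) (simp add: power2_eq_square algebra_simps)

text \<open>On the circle of radius s the distance from 1 is at most 1 + s, which gives the value (1
  - s) / (1 + s) taken at - s; this value decreases in s.\<close>

lemma Re_cayley_ge:
  assumes "norm w \<le> r" "r \<le> 1" "w \<noteq> 1"
  shows "(1 - r) / (1 + r) \<le> Re (cayley w)"
proof -
  have "(1 - r) / (1 + r) \<le> (1 - norm w) / (1 + norm w)"
  proof (rule frac_le)
    show "0 < 1 + norm w" using norm_ge_zero[of w] by linarith
  qed (use assms norm_ge_zero[of w] in auto)
  also have "\<dots> = (1 - (norm w)\<^sup>2) / (1 + norm w)\<^sup>2"
  proof -
    have "1 + norm w > 0" using norm_ge_zero[of w] by linarith
    then show ?thesis by (simp add: divide_simps power2_eq_square) (simp add: algebra_simps)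
  qed
  also have "\<dots> \<le> (1 - (norm w)\<^sup>2) / (norm (1 - w))\<^sup>2"
  proof (rule divide_left_mono)
    have "norm (1 - w) \<le> 1 + norm w" using norm_triangle_ineq4[of 1 w] by simp
    then show "(norm (1 - w))\<^sup>2 \<le> (1 + norm w)\<^sup>2" by (intro power_mono) auto
    show "0 \<le> 1 - (norm w)\<^sup>2" using assms by (simp add: power_le_one)
    show "0 < (1 + norm w)\<^sup>2 * (norm (1 - w))\<^sup>2"
    proof (intro mult_pos_pos zero_less_power)
      show "0 < 1 + norm w" using norm_ge_zero[of w] by linarith
      show "0 < norm (1 - w)" using assms by simp
    qed
  qed
  finally show ?thesis by (simp add: Re_cayley)
qed

lemma continuous_on_squeezing_integrand:
  assumes "\<alpha> < 1"
  shows "continuous_on {0..1} (\<lambda>t::real. (1 - t powr (1 - \<alpha>)) / (1 + t powr (1 - \<alpha>)))"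
proof (intro continuous_on_divide continuous_on_add continuous_on_diff continuous_on_const
    continuous_on_powr_unit assms ballI)
  fix t :: real assume "t \<in> {0..1}"
  from powr_in_unit_interval[OF assms this] have "0 < 1 + t powr (1 - \<alpha>)" by (simp add: add_pos_nonneg)
  then show "1 + t powr (1 - \<alpha>) \<noteq> 0" by simp
qed

lemma squeezing_const_pos:
  assumes "\<alpha> < 1"
  shows "\<kappa> \<alpha> > 0"
proof -
  let ?g = "\<lambda>t::real. (1 - t powr (1 - \<alpha>)) / (1 + t powr (1 - \<alpha>))"
  have nn: "?g t \<ge> 0" if "t \<in> {0..1}" for t
    using powr_in_unit_interval[OF assms that] by auto
  have i: "?g integrable_on {0..1}"
    using continuous_on_squeezing_integrand[OF assms] by (rule integrable_continuous_interval)
  have "\<kappa> \<alpha> \<noteq> 0"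
  proof
    assume "\<kappa> \<alpha> = 0"
    then have "(?g has_integral 0) (cbox 0 1)"
      using i by (simp add: squeezing_const_def has_integral_integral)
    \<comment> \<open>A continuous nonnegative function with integral 0 vanishes, but
      \<open>0 powr (1 - \<alpha>) = 0\<close> makes the integrand 1 at 0.\<close>
    then have "?g 0 = 0"
      by (rule has_integral_0_cbox_imp_0[rotated 2])
         (use nn continuous_on_squeezing_integrand[OF assms] in simp_all)
    with assms show False by simp
  qed
  moreover have "\<kappa> \<alpha> \<ge> 0"
    unfolding squeezing_const_def using nn i by (intro integral_nonneg) auto
  ultimately show ?thesis by simp
qed

text \<open>The bound holds for each t separately, with radius \<open>t powr (1 - \<alpha>)\<close>
  in \<open>Re_cayley_ge\<close>. All these minima are attained at the same point z = -1, so
  \<open>\<kappa> \<alpha>\<close> is the value of \<open>F \<alpha>\<close> at -1 and the bound is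
  sharp.\<close>

lemma Re_F_ge_squeezing_const:
  assumes "\<alpha> < 1" "norm z \<le> 1" "z \<noteq> 1"
  shows "\<kappa> \<alpha> \<le> Re (F \<alpha> z)"
proof -
  have z: "z \<in> slit_plane" using assms cball_subset_slit_plane by auto
  have "((\<lambda>t::real. (1 - t powr (1 - \<alpha>)) / (1 + t powr (1 - \<alpha>))) has_integral \<kappa> \<alpha>) {0..1}"
    unfolding squeezing_const_def using continuous_on_squeezing_integrand[OF assms(1)]
    by (intro integrable_integral integrable_continuous_interval)
  then show ?thesis
  proof (rule has_integral_le[OF _ has_integral_Re[OF F_has_integral[OF assms(1) z]]])
    fix t :: real assume t: "t \<in> {0..1}"
    let ?s = "t powr (1 - \<alpha>)"
    have s: "?s \<in> {0..1}" using powr_in_unit_interval[OF assms(1) t] .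
    show "(1 - ?s) / (1 + ?s) \<le> Re (cayley (of_real ?s * z))"
    proof (rule Re_cayley_ge)
      have "?s * norm z \<le> ?s * 1" using s assms by (intro mult_left_mono) auto
      then show "norm (of_real ?s * z) \<le> ?s" using s by (simp add: norm_mult)
      show "of_real ?s * z \<noteq> 1" using slit_plane_scaled_ne_1[OF z s] .
    qed (use s in simp)
  qed
qed

lemma Re_F_pos: "\<alpha> < 1 \<Longrightarrow> norm z \<le> 1 \<Longrightarrow> z \<noteq> 1 \<Longrightarrow> 0 < Re (F \<alpha> z)"
  using Re_F_ge_squeezing_const squeezing_const_pos by (meson less_le_trans)

section \<open>Boundedness of the imaginary part of F\<close>

text \<open>Along the circle the real part of \<open>F \<alpha>\<close> blows up at 1 while the
  imaginary part stays bounded. This drives \<open>Arg (F \<alpha> z)\<close> to 0 there and later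
  bounds the exponential in \<open>Re_cis_F_nonneg\<close>.\<close>

lemma Im_F_bounds_upper:
  assumes "\<alpha> < 1" "Im z > 0"
  shows "0 < Im (F \<alpha> z)" "Im (F \<alpha> z) \<le> 2 * pi / (1 - \<alpha>)"
proof -
  have z: "z \<in> slit_plane"
    using assms(2) by (auto simp: slit_plane_def complex_nonpos_Reals_iff)
  let ?s = "\<lambda>t::real. t powr (1 - \<alpha>)"
  let ?h = "\<lambda>t. Im (cayley (of_real (?s t) * z))"
  let ?G = "\<lambda>t. arctan ((?s t * (norm z)\<^sup>2 - Re z) / Im z)"
  let ?g = "\<lambda>t. (1 - \<alpha>) * t powr (- \<alpha>) * Im z / (norm (1 - of_real (?s t) * z))\<^sup>2"
  have s01: "?s t \<in> {0..1}" if "t \<in> {0..1}" for t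
    using powr_in_unit_interval[OF assms(1) that] .
  have int: "(?h has_integral Im (F \<alpha> z)) {0..1}"
    using has_integral_Im[OF F_has_integral[OF assms(1) z]] .
  have nn: "0 \<le> ?h t" if "t \<in> {0..1}" for t
    using assms(2) s01[OF that] by (simp add: Im_cayley)
  \<comment> \<open>If the integral vanished, so would its continuous nonnegative integrand at t =
    1, where it is \<open>Im (cayley z) > 0\<close>.\<close>
  have "Im (F \<alpha> z) \<noteq> 0"
  proof
    assume "Im (F \<alpha> z) = 0"
    then have "(?h has_integral 0) (cbox 0 1)" using int by simp
    moreover have "continuous_on (cbox 0 1) ?h"
      using continuous_on_cayley_powr[OF assms(1) z] by (auto intro!: continuous_intros)
    ultimately have "?h 1 = 0"
      by (intro has_integral_0_cbox_imp_0[of 0 1 ?h 1]) (use nn in simp_all)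
    moreover have "z \<noteq> 1" using assms(2) by auto
    ultimately show False using assms(2) by (simp add: Im_cayley)
  qed
  then show "0 < Im (F \<alpha> z)"
    using has_integral_nonneg[OF int] nn by fastforce
  have scale: "inverse (n\<^sup>2 * N\<^sup>2 / y\<^sup>2) * (a * n\<^sup>2 / y) = a * y / N\<^sup>2"
    if "n \<noteq> 0" "N \<noteq> 0" "y \<noteq> 0" for n N y a :: real
    using that by (simp add: divide_simps power2_eq_square)
  text \<open>The integrand of \<open>Im (F \<alpha> z)\<close> is at most a constant multiple of the derivative of the bounded
    function \<open>?G\<close>, since \<open>t powr (1 - \<alpha>) \<le> t powr (- \<alpha>)\<close>.\<close>
  have der: "(?G has_vector_derivative ?g t) (at t)" if "t \<in> {0<..<1}" for t
  proof -
    let ?u = "(?s t * (norm z)\<^sup>2 - Re z) / Im z"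
    have "((\<lambda>t. (?s t * (norm z)\<^sup>2 - Re z) / Im z) has_real_derivative ((1 - \<alpha>) * t powr (- \<alpha>) * (norm z)\<^sup>2) / Im z) (at t)"
      using that assms(2) by (auto intro!: derivative_eq_intros)
    from DERIV_chain2[OF DERIV_arctan this]
    have "(?G has_real_derivative inverse (1 + ?u\<^sup>2) * (((1 - \<alpha>) * t powr (- \<alpha>) * (norm z)\<^sup>2) / Im z)) (at t)" .
    \<comment> \<open>Completing the square in s: |z|^2 |1 - s z|^2 = (s |z|^2 - Re z)^2 + (Im z)^2.
      This identity dictates the argument of \<open>arctan\<close> in \<open>?G\<close>.\<close>
    moreover have "1 + ?u\<^sup>2 = (norm z)\<^sup>2 * (norm (1 - of_real (?s t) * z))\<^sup>2 / (Im z)\<^sup>2"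
      using assms(2) unfolding cmod_power2
      by (simp add: divide_simps) (simp add: power2_eq_square algebra_simps)
    then have "inverse (1 + ?u\<^sup>2) * (((1 - \<alpha>) * t powr (- \<alpha>) * (norm z)\<^sup>2) / Im z) = ?g t"
      using scale[of "norm z" "norm (1 - of_real (?s t) * z)" "Im z" "(1 - \<alpha>) * t powr (- \<alpha>)"]
        assms(2) slit_plane_scaled_ne_1[OF z s01[of t]] that by auto
    ultimately show ?thesis by (simp add: has_real_derivative_iff_has_vector_derivative)
  qed
  have "(?g has_integral (?G 1 - ?G 0)) {0..1}"
  proof (rule fundamental_theorem_of_calculus_interior)
    show "continuous_on {0..1} ?G"
      using assms(2) by (intro continuous_intros continuous_on_powr_unit assms(1)) auto
  qed (use der in auto)
  from has_integral_mult_right[OF this, of "2 / (1 - \<alpha>)"]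
  have "((\<lambda>t. 2 / (1 - \<alpha>) * ?g t) has_integral (2 / (1 - \<alpha>) * (?G 1 - ?G 0))) {0..1}" .
  then have "Im (F \<alpha> z) \<le> 2 / (1 - \<alpha>) * (?G 1 - ?G 0)"
  proof (rule has_integral_le[OF int])
    fix t :: real assume t: "t \<in> {0..1}"
    \<comment> \<open>At t = 0 both sides are 0, since \<open>0 powr x = 0\<close> for every
      exponent, negative ones included.\<close>
    have "?s t \<le> t powr (- \<alpha>)"
      using t by (cases "t = 0") (auto intro: powr_mono')
    then have "2 * ?s t * Im z / (norm (1 - of_real (?s t) * z))\<^sup>2
               \<le> 2 * t powr (- \<alpha>) * Im z / (norm (1 - of_real (?s t) * z))\<^sup>2"
      using assms(2) by (intro divide_right_mono mult_right_mono mult_left_mono) auto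
    then show "?h t \<le> 2 / (1 - \<alpha>) * ?g t"
      using assms(1) by (simp add: Im_cayley mult_ac)
  qed
  also have "?G 1 - ?G 0 \<le> pi"
    using arctan_bounded[of "(?s 1 * (norm z)\<^sup>2 - Re z) / Im z"]
      arctan_bounded[of "(?s 0 * (norm z)\<^sup>2 - Re z) / Im z"] by linarith
  then have "2 / (1 - \<alpha>) * (?G 1 - ?G 0) \<le> 2 / (1 - \<alpha>) * pi"
    using assms(1) by (intro mult_left_mono) auto
  finally show "Im (F \<alpha> z) \<le> 2 * pi / (1 - \<alpha>)" by simp
qed

lemma abs_Im_F_le:
  assumes "\<alpha> < 1" "z \<in> slit_plane"
  shows "\<bar>Im (F \<alpha> z)\<bar> \<le> 2 * pi / (1 - \<alpha>)"
proof (cases "Im z" "0::real" rule: linorder_cases)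
  case greater
  then show ?thesis using Im_F_bounds_upper[OF assms(1) greater] by simp
next
  case less
  then have "Im (cnj z) > 0" by simp
  from Im_F_bounds_upper[OF assms(1) this] show ?thesis by (simp add: F_cnj[OF assms])
next
  case equal
  then have "cnj z = z" by (simp add: complex_eq_iff)
  then have "F \<alpha> z = cnj (F \<alpha> z)" using F_cnj[OF assms] by simp
  then have "Im (F \<alpha> z) = 0" by (simp add: complex_eq_iff)
  then show ?thesis using assms(1) by simp
qed

section \<open>Logarithmic growth of the real part of F at the boundary point 1\<close>

text \<open>For b \<le> 1 the power lies above t; for b > 1 the mean value theorem bounds the slope
  by b. It replaces 1 - s by 1 - t, up to a constant, for s =
  \<open>t powr (1 - \<alpha>)\<close>.\<close>

lemma one_minus_powr_le:
  fixes t b :: real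
  assumes "b > 0" "0 \<le> t" "t \<le> 1"
  shows "1 - t powr b \<le> max 1 b * (1 - t)"
proof (cases "t = 0")
  case False
  then have t: "t > 0" using assms by simp
  show ?thesis
  proof (cases "b \<le> 1")
    case True
    have "t powr 1 \<le> t powr b" using assms True by (intro powr_mono') auto
    then show ?thesis using t True by (simp add: max_def)
  next
    case False
    have *: "((\<lambda>x. x powr b) has_real_derivative b * x powr (b - 1)) (at x)"
      if "t \<le> x" "x \<le> 1" for x
      using t that by (auto intro!: derivative_eq_intros)
    show ?thesis
    proof (cases "t = 1")
      case False
      with assms have "t < 1" by simp
      from MVT2[OF this *] obtain x where
        x: "t < x" "x < 1" "1 powr b - t powr b = (1 - t) * (b * x powr (b - 1))" by blast
      have "x powr (b - 1) \<le> 1" using x t \<open>\<not> b \<le> 1\<close> by (intro powr_le1) auto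
      then have "(1 - t) * (b * x powr (b - 1)) \<le> (1 - t) * (b * 1)"
        using assms by (intro mult_left_mono) auto
      then show ?thesis using x \<open>\<not> b \<le> 1\<close> by (simp add: mult.commute max_def)
    qed auto
  qed
qed auto

lemma norm_one_minus_cis_le: "\<theta> \<ge> 0 \<Longrightarrow> norm (1 - cis \<theta>) \<le> \<theta>"
proof -
  assume "\<theta> \<ge> 0"
  have "norm (cis \<theta> - 1) = 2 * \<bar>sin (\<theta> / 2)\<bar>"
    using dist_exp_i_1[of \<theta>] by (simp add: cis_conv_exp mult.commute)
  also have "\<dots> \<le> 2 * (\<theta> / 2)"
    using \<open>\<theta> \<ge> 0\<close> abs_sin_x_le_abs_x[of "\<theta> / 2"] by simp
  finally show ?thesis by (simp add: norm_minus_commute)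
qed

text \<open>Only the integral up to \<open>T\<close> is estimated, where s =
  \<open>t powr (1 - \<alpha>)\<close> is at most 1 - \<theta>; the rest is nonnegative. There |1 -
  s cis \<theta>| \<le> (1 - s) + \<theta> \<le> 2 (1 - s), so the integrand is at least 1 / (4 (1 -
  s)), hence at least 1 / (4 C (1 - t)), which integrates to the logarithm.\<close>

lemma Re_F_cis_lower_bound:
  assumes "\<alpha> < 1" "0 < \<theta>" "\<theta> < 1"
  shows "- ln (1 - (1 - \<theta>) powr (1 / (1 - \<alpha>))) / (4 * max 1 (1 - \<alpha>)) \<le> Re (F \<alpha> (cis \<theta>))"
proof -
  define C where "C = max 1 (1 - \<alpha>)"
  define T where "T = (1 - \<theta>) powr (1 / (1 - \<alpha>))"
  have C: "C \<ge> 1" by (simp add: C_def)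
  have T: "0 < T" "T < 1"
    using assms powr_less_mono2[of "1 / (1 - \<alpha>)" "1 - \<theta>" 1] by (auto simp: T_def)
  let ?s = "\<lambda>t::real. t powr (1 - \<alpha>)"
  let ?h = "\<lambda>t. Re (cayley (of_real (?s t) * cis \<theta>))"
  have z: "cis \<theta> \<in> slit_plane"
    using assms pi_gt3 by (intro cis_in_slit_plane) auto
  have int: "(?h has_integral Re (F \<alpha> (cis \<theta>))) {0..1}"
    using has_integral_Re[OF F_has_integral[OF assms(1) z]] .
  have "((\<lambda>t. 1 / (4 * C) * (1 / (1 - t))) has_integral
           (- ln (1 - T) / (4 * C) - (- ln (1 - 0) / (4 * C)))) {0..T}"
    using T C
    by (intro fundamental_theorem_of_calculus)
       (auto intro!: derivative_eq_intros simp: has_real_derivative_iff_has_vector_derivative[symmetric] field_simps)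
  then have int': "((\<lambda>t. 1 / (4 * C) * (1 / (1 - t))) has_integral - ln (1 - T) / (4 * C)) {0..T}"
    by simp
  have "?h integrable_on {0..T}"
    by (rule integrable_subinterval_real[OF has_integral_integrable[OF int]]) (use T in auto)
  then have int'': "(?h has_integral integral {0..T} ?h) {0..T}" by (rule integrable_integral)
  have "- ln (1 - T) / (4 * C) \<le> integral {0..T} ?h"
  proof (rule has_integral_le[OF int' int''])
    fix t assume t: "t \<in> {0..T}"
    have "?s t \<le> T powr (1 - \<alpha>)" using t assms by (intro powr_mono2) auto
    also have "\<dots> = 1 - \<theta>" using assms by (simp add: T_def powr_powr)
    finally have s: "0 \<le> ?s t" "?s t \<le> 1 - \<theta>" by auto
    have "norm (1 - of_real (?s t) * cis \<theta>) = norm ((1 - of_real (?s t)) + of_real (?s t) * (1 - cis \<theta>))"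
      by (simp add: algebra_simps)
    also have "\<dots> \<le> norm (1 - complex_of_real (?s t)) + norm (of_real (?s t) * (1 - cis \<theta>))"
      by (rule norm_triangle_ineq)
    also have "norm (1 - complex_of_real (?s t)) = 1 - ?s t"
      using norm_of_real[of "1 - ?s t", where 'a = complex] s assms by simp
    also have "norm (of_real (?s t) * (1 - cis \<theta>)) \<le> 1 * \<theta>"
      unfolding norm_mult using s assms by (intro mult_mono norm_one_minus_cis_le) auto
    finally have n: "norm (1 - of_real (?s t) * cis \<theta>) \<le> 2 * (1 - ?s t)" using s by simp
    have ne: "of_real (?s t) * cis \<theta> \<noteq> 1"
      using slit_plane_scaled_ne_1[OF z, of "?s t"] s assms by auto
    have "1 / (4 * C) * (1 / (1 - t)) = 1 / (4 * (C * (1 - t)))"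
      by simp
    also have "\<dots> \<le> 1 / (4 * (1 - ?s t))"
      using one_minus_powr_le[of "1 - \<alpha>" t] s t T assms by (intro divide_left_mono) (auto simp: C_def)
    also have "\<dots> = (1 - ?s t) / (2 * (1 - ?s t))\<^sup>2"
    proof -
      have "1 - ?s t > 0" using s assms by simp
      then show ?thesis by (simp only: power2_eq_square) (simp only: field_simps, simp)
    qed
    also have "\<dots> \<le> (1 - (?s t)\<^sup>2) / (norm (1 - of_real (?s t) * cis \<theta>))\<^sup>2"
    proof (rule frac_le)
      have "(?s t)\<^sup>2 \<le> ?s t * 1" unfolding power2_eq_square using s assms by (intro mult_left_mono) auto
      then show "1 - ?s t \<le> 1 - (?s t)\<^sup>2" by simp
      show "0 \<le> 1 - (?s t)\<^sup>2" using s assms by (simp add: power_le_one)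
      show "0 < (norm (1 - of_real (?s t) * cis \<theta>))\<^sup>2" using ne by simp
      show "(norm (1 - of_real (?s t) * cis \<theta>))\<^sup>2 \<le> (2 * (1 - ?s t))\<^sup>2"
        using n by (intro power_mono) auto
    qed
    finally show "1 / (4 * C) * (1 / (1 - t)) \<le> ?h t"
      using s by (simp add: Re_cayley norm_mult)
  qed
  also have "\<dots> \<le> Re (F \<alpha> (cis \<theta>))"
  proof (rule has_integral_subset_le[OF _ int'' int ballI])
    show "0 \<le> ?h t" if "t \<in> {0..1}" for t
      using powr_in_unit_interval[OF assms(1) that]
      by (auto simp: Re_cayley norm_mult power_le_one intro!: divide_nonneg_nonneg)
  qed (use T in auto)
  finally show ?thesis by (simp add: C_def T_def)
qed

lemma filterlim_Re_F_cis:
  assumes "\<alpha> < 1"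
  shows "filterlim (\<lambda>\<theta>. Re (F \<alpha> (cis \<theta>))) at_top (at_right 0)"
proof (rule filterlim_at_top_mono)
  define C where "C = 4 * max 1 (1 - \<alpha>)"
  have C: "C > 0" by (auto simp: C_def)
  show "\<forall>\<^sub>F \<theta> in at_right 0. - ln (1 - (1 - \<theta>) powr (1 / (1 - \<alpha>))) / C \<le> Re (F \<alpha> (cis \<theta>))"
    using eventually_at_right_real[OF zero_less_one]
    by eventually_elim (use Re_F_cis_lower_bound[OF assms] in \<open>auto simp: C_def\<close>)
  have "((\<lambda>\<theta>. 1 - (1 - \<theta>) powr (1 / (1 - \<alpha>))) \<longlongrightarrow> 1 - (1 - 0) powr (1 / (1 - \<alpha>))) (at_right (0::real))"
    by (intro tendsto_intros) auto
  moreover have "\<forall>\<^sub>F \<theta> in at_right 0. 1 - (1 - \<theta>) powr (1 / (1 - \<alpha>)) \<in> {0<..} - {0}"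
    using eventually_at_right_real[OF zero_less_one]
    by eventually_elim (use assms powr_less_mono2[of "1 / (1 - \<alpha>)" _ 1] in auto)
  ultimately have "filterlim (\<lambda>\<theta>. 1 - (1 - \<theta>) powr (1 / (1 - \<alpha>))) (at_right 0) (at_right (0::real))"
    by (auto simp: filterlim_at elim: eventually_mono)
  then have "filterlim (\<lambda>\<theta>. ln (1 - (1 - \<theta>) powr (1 / (1 - \<alpha>)))) at_bot (at_right (0::real))"
    by (rule filterlim_compose[OF ln_at_0])
  then have "filterlim (\<lambda>\<theta>. - ln (1 - (1 - \<theta>) powr (1 / (1 - \<alpha>)))) at_top (at_right (0::real))"
    by (simp add: filterlim_uminus_at_top)
  then show "filterlim (\<lambda>\<theta>. - ln (1 - (1 - \<theta>) powr (1 / (1 - \<alpha>))) / C) at_top (at_right (0::real))"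
  proof -
    assume "filterlim (\<lambda>\<theta>. - ln (1 - (1 - \<theta>) powr (1 / (1 - \<alpha>)))) at_top (at_right (0::real))"
    from filterlim_tendsto_pos_mult_at_top[OF tendsto_const _ this, of "1 / C"] C
    show ?thesis by simp
  qed
qed

section \<open>The sector containing F\<close>

lemma Arg_Re_pos_bounds: "0 < Re w \<Longrightarrow> \<bar>Arg w\<bar> < pi / 2"
  using arctan_bounded[of "Im w / Re w"] by (simp only: arg_conv_arctan) linarith

lemma cis_ne_1: "0 < \<theta> \<Longrightarrow> \<theta> < 2 * pi \<Longrightarrow> cis \<theta> \<noteq> 1"
  using cis_in_slit_plane[of \<theta>] by (auto simp: slit_plane_def)

text \<open>The \<open>GREATEST\<close> in the definition of \<open>\<delta>\<close> denotes the
  maximum only once this is attained on the open interval. Near 0 the argument drops below its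
  positive value at pi / 2 because the real part grows; at pi it is 0; between, it is continuous on
  a compact interval. Positivity of the real part keeps it below pi / 2, hence
  \<open>\<delta> \<alpha> < 1\<close>.\<close>

lemma sector_const_attained:
  assumes "\<alpha> < 1"
  obtains \<theta>0 where "0 < \<theta>0" "\<theta>0 < pi" "Arg (F \<alpha> (cis \<theta>0)) = pi * \<delta> \<alpha> / 2"
    "\<And>\<theta>. 0 < \<theta> \<Longrightarrow> \<theta> < pi \<Longrightarrow> Arg (F \<alpha> (cis \<theta>)) \<le> pi * \<delta> \<alpha> / 2"
    "0 < \<delta> \<alpha>" "\<delta> \<alpha> < 1"
proof -
  let ?A = "\<lambda>\<theta>. Arg (F \<alpha> (cis \<theta>))"
  have pos: "0 < Re (F \<alpha> (cis \<theta>))" if "0 < \<theta>" "\<theta> \<le> pi" for \<theta>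
    using that Re_F_pos[OF assms, of "cis \<theta>"] cis_ne_1[of \<theta>] by auto
  have A: "?A \<theta> = arctan (Im (F \<alpha> (cis \<theta>)) / Re (F \<alpha> (cis \<theta>)))" if "0 < \<theta>" "\<theta> \<le> pi" for \<theta>
    using pos[OF that] by (rule arg_conv_arctan)
  define a where "a = ?A (pi / 2)"
  have "0 < Im (F \<alpha> (cis (pi / 2)))"
    by (rule Im_F_bounds_upper[OF assms]) simp
  then have a: "0 < a"
    using pos[of "pi / 2"] A[of "pi / 2"] pi_gt_zero unfolding a_def
    by (metis divide_pos_pos half_gt_zero less_eq_real_def field_sum_of_halves less_add_same_cancel1 zero_less_arctan_iff)
  have "a < pi / 2"
    using Arg_Re_pos_bounds[OF pos[of "pi / 2"]] by (simp add: a_def)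
  then have tan_a: "0 < tan a" using a by (intro tan_gt_zero)
  define B where "B = 2 * pi / (1 - \<alpha>)"
  \<comment> \<open>Beyond this threshold Im F / Re F is below \<open>tan a\<close>, because Im F is
    at most \<open>B\<close>; the summand 1 makes the inequality strict.\<close>
  have "\<forall>\<^sub>F \<theta> in at_right 0. B / tan a + 1 \<le> Re (F \<alpha> (cis \<theta>))"
    using filterlim_Re_F_cis[OF assms] by (simp add: filterlim_at_top)
  then obtain e where e: "e > 0" "\<And>\<theta>. 0 < \<theta> \<Longrightarrow> \<theta> < e \<Longrightarrow> B / tan a + 1 \<le> Re (F \<alpha> (cis \<theta>))"
    by (auto simp: eventually_at_right_field)
  \<comment> \<open>Smaller than \<open>e\<close>, and at most pi / 2 so that the comparison point
    pi / 2 lies in the compact interval.\<close>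
  define d where "d = min (e / 2) (pi / 2)"
  have d: "0 < d" "d < e" "d \<le> pi / 2" using e by (auto simp: d_def min_def)
  have small: "?A \<theta> < a" if "0 < \<theta>" "\<theta> \<le> d" for \<theta>
  proof -
    have th: "\<theta> < e" "\<theta> \<le> pi" "\<theta> < pi" using that d by auto
    have "Im (F \<alpha> (cis \<theta>)) \<le> B"
      using abs_Im_F_le[OF assms cis_in_slit_plane[of \<theta>]] th that by (simp add: B_def)
    also have "\<dots> < Re (F \<alpha> (cis \<theta>)) * tan a"
    proof -
      have "B < (B / tan a + 1) * tan a" using tan_a by (simp add: field_simps)
      also have "\<dots> \<le> Re (F \<alpha> (cis \<theta>)) * tan a"
        using e(2)[of \<theta>] that th tan_a by (intro mult_right_mono) auto
      finally show ?thesis .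
    qed
    finally have "Im (F \<alpha> (cis \<theta>)) / Re (F \<alpha> (cis \<theta>)) < tan a"
      using pos[of \<theta>] that th by (simp add: field_simps)
    then have "arctan (Im (F \<alpha> (cis \<theta>)) / Re (F \<alpha> (cis \<theta>))) < arctan (tan a)"
      by (simp add: arctan_less_iff)
    also have "arctan (tan a) = a"
      using a \<open>a < pi / 2\<close> by (intro arctan_tan) auto
    finally show ?thesis using A[of \<theta>] that th by simp
  qed
  have contF: "continuous_on {d..pi} (\<lambda>\<theta>. F \<alpha> (cis \<theta>))"
  proof (rule continuous_on_compose2[OF holomorphic_on_imp_continuous_on[OF F_holomorphic[OF assms]]])
    show "continuous_on {d..pi} cis" unfolding cis_conv_exp by (intro continuous_intros)
    show "cis ` {d..pi} \<subseteq> slit_plane"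
    proof (rule image_subsetI)
      fix x assume "x \<in> {d..pi}"
      then have "0 < x" "x < 2 * pi" using d pi_gt_zero by auto
      then show "cis x \<in> slit_plane" by (rule cis_in_slit_plane)
    qed
  qed
  have "continuous_on {d..pi} (\<lambda>\<theta>. arctan (Im (F \<alpha> (cis \<theta>)) / Re (F \<alpha> (cis \<theta>))))"
  proof (intro continuous_intros contF ballI)
    fix x assume "x \<in> {d..pi}"
    then show "Re (F \<alpha> (cis x)) \<noteq> 0" using pos[of x] d by auto
  qed
  then have contA: "continuous_on {d..pi} ?A"
    by (rule continuous_on_eq) (use A d in auto)
  have "{d..pi} \<noteq> {}" using d pi_gt_zero by auto
  from continuous_attains_sup[OF compact_Icc this contA]
  obtain \<theta>0 where t0: "\<theta>0 \<in> {d..pi}" "\<And>\<theta>. \<theta> \<in> {d..pi} \<Longrightarrow> ?A \<theta> \<le> ?A \<theta>0" by blast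
  have "pi / 2 \<in> {d..pi}" using d pi_gt_zero by auto
  then have ge_a: "a \<le> ?A \<theta>0" unfolding a_def by (rule t0(2))
  have "?A pi = 0"
  proof -
    have "cnj (F \<alpha> (cis pi)) = F \<alpha> (cis pi)"
      using F_cnj[OF assms cis_in_slit_plane[of pi]] by simp
    then have "Im (F \<alpha> (cis pi)) = 0" by (auto simp: complex_eq_iff)
    then show ?thesis using A[of pi] by simp
  qed
  then have "\<theta>0 \<noteq> pi" using ge_a a by auto
  then have t0': "0 < \<theta>0" "\<theta>0 < pi" using t0(1) d by auto
  have le: "?A \<theta> \<le> ?A \<theta>0" if "0 < \<theta>" "\<theta> < pi" for \<theta>
  proof (cases "\<theta> \<le> d")
    case True
    then show ?thesis using small[of \<theta>] that ge_a by simp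
  next
    case False
    then show ?thesis using t0(2)[of \<theta>] that by simp
  qed
  have "(GREATEST x. x \<in> ?A ` {0<..<pi}) = ?A \<theta>0"
    by (rule Greatest_equality) (use t0' le in auto)
  then have eq: "?A \<theta>0 = pi * \<delta> \<alpha> / 2"
    by (simp add: sector_const_def)
  have "0 < pi * \<delta> \<alpha>" using a ge_a eq by simp
  then have "0 < \<delta> \<alpha>" using pi_gt_zero zero_less_mult_pos by blast
  moreover have "pi * \<delta> \<alpha> / 2 < pi / 2"
    using Arg_Re_pos_bounds[OF pos[of \<theta>0]] t0' eq by linarith
  then have "\<delta> \<alpha> < 1" by simp
  ultimately show ?thesis using that[of \<theta>0] t0' le eq by auto
qed

lemma abs_Arg_F_circle_le:
  assumes "\<alpha> < 1" "norm z = 1" "z \<noteq> 1"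
  shows "\<bar>Arg (F \<alpha> z)\<bar> \<le> pi * \<delta> \<alpha> / 2"
proof -
  obtain \<theta>0 where th: "\<And>\<theta>. 0 < \<theta> \<Longrightarrow> \<theta> < pi \<Longrightarrow> Arg (F \<alpha> (cis \<theta>)) \<le> pi * \<delta> \<alpha> / 2" "0 < \<delta> \<alpha>"
    using sector_const_attained[OF assms(1)] by metis
  have upper: "\<bar>Arg (F \<alpha> w)\<bar> \<le> pi * \<delta> \<alpha> / 2" if "norm w = 1" "w \<noteq> 1" "Im w > 0" for w
  proof -
    have "0 < Arg w \<and> Arg w < pi"
      using that by (simp add: Arg_lt_pi)
    moreover have "w = cis (Arg w)"
      using that by (metis complex_norm_eq_1_exp_eq cis_Arg norm_zero sgn_eq div_by_1 of_real_1 zero_neq_one)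
    ultimately have "Arg (F \<alpha> w) \<le> pi * \<delta> \<alpha> / 2" using th(1) by metis
    moreover have "0 < Arg (F \<alpha> w)"
      using Im_F_bounds_upper[OF assms(1) that(3)] Re_F_pos[OF assms(1), of w] that
      by (simp add: arg_conv_arctan)
    ultimately show ?thesis by simp
  qed
  have z: "z \<in> slit_plane" using assms by (intro cball_subset_slit_plane) auto
  have cnj: "\<bar>Arg (F \<alpha> z)\<bar> = \<bar>Arg (F \<alpha> (cnj z))\<bar>"
    by (simp add: F_cnj[OF assms(1) z] Arg_cnj)
  show ?thesis
  proof (cases "Im z" "0::real" rule: linorder_cases)
    case less
    have "cnj z \<noteq> 1" using assms(3) by (metis complex_cnj_cnj complex_cnj_one)
    then show ?thesis using upper[of "cnj z"] less assms cnj by simp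
  next
    case greater
    then show ?thesis using upper assms by blast
  next
    case equal
    then have "cnj z = z" by (simp add: complex_eq_iff)
    then have "cnj (F \<alpha> z) = F \<alpha> z" using F_cnj[OF assms(1) z] by simp
    then have "Im (F \<alpha> z) = 0" by (auto simp: complex_eq_iff)
    then have "Arg (F \<alpha> z) = 0" using Re_F_pos[OF assms(1), of z] assms by (simp add: arg_conv_arctan)
    then show ?thesis using th(2) by simp
  qed
qed

section \<open>Passage from the circle to the disk\<close>

text \<open>A sector around the positive axis is the intersection of two half-planes. Half-plane
  conditions are linear in \<open>w\<close>, so they pass to averages and, as bounds on harmonic
  functions, from the circle to the disk.\<close>

lemma Re_cis_mult_nonneg_iff:
  assumes "0 < Re w" "0 \<le> A" "A \<le> pi / 2"
  shows "\<bar>Arg w\<bar> \<le> pi / 2 - A \<longleftrightarrow> 0 \<le> Re (cis A * w) \<and> 0 \<le> Re (cis (- A) * w)"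
proof -
  define r where "r = norm w"
  define b where "b = Arg w"
  have r: "0 < r" using assms by (auto simp: r_def)
  have w: "w = rcis r b" by (simp add: r_def b_def rcis_cmod_Arg)
  have b: "\<bar>b\<bar> < pi / 2" using Arg_Re_pos_bounds[OF assms(1)] by (simp add: b_def)
  have key: "0 \<le> cos x \<longleftrightarrow> \<bar>x\<bar> \<le> pi / 2" if "\<bar>x\<bar> \<le> pi" for x :: real
  proof
    assume "0 \<le> cos x"
    show "\<bar>x\<bar> \<le> pi / 2"
    proof (rule ccontr)
      assume "\<not> \<bar>x\<bar> \<le> pi / 2"
      then have "cos \<bar>x\<bar> < cos (pi / 2)" using that by (intro cos_monotone_0_pi) auto
      then show False using \<open>0 \<le> cos x\<close> by simp
    qed
  next
    assume "\<bar>x\<bar> \<le> pi / 2"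
    then show "0 \<le> cos x" by (intro cos_ge_zero) auto
  qed
  have "Re (cis A * w) = r * cos (A + b)" "Re (cis (- A) * w) = r * cos (- A + b)"
    by (simp_all add: w rcis_def cos_add cos_diff algebra_simps)
  then have "0 \<le> Re (cis A * w) \<and> 0 \<le> Re (cis (- A) * w) \<longleftrightarrow> 0 \<le> cos (A + b) \<and> 0 \<le> cos (- A + b)"
    using r by (simp add: zero_le_mult_iff)
  also have "\<dots> \<longleftrightarrow> \<bar>A + b\<bar> \<le> pi / 2 \<and> \<bar>- A + b\<bar> \<le> pi / 2"
    using b assms key[of "A + b"] key[of "- A + b"] by linarith
  also have "\<dots> \<longleftrightarrow> \<bar>b\<bar> \<le> pi / 2 - A" using assms by linarith
  finally show ?thesis by (simp add: b_def)
qed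

text \<open>A Phragmen-Lindelof argument: for g = exp (- cis \<tau> F) the claim is |g| \<le> 1. The
  definition of \<open>\<delta>\<close> gives this on the circle except at 1, and positivity of Re F
  with boundedness of Im F gives |g| \<le> exp B on the closed disk without 1, so the single
  exceptional point does no harm.\<close>

lemma Re_cis_F_nonneg:
  assumes "\<alpha> < 1" "z \<in> \<bbbD>" "\<bar>\<tau>\<bar> \<le> pi * (1 - \<delta> \<alpha>) / 2"
  shows "0 \<le> Re (cis \<tau> * F \<alpha> z)"
proof -
  have d: "0 < \<delta> \<alpha>" "\<delta> \<alpha> < 1" using sector_const_attained[OF assms(1)] by metis+
  define B where "B = 2 * pi / (1 - \<alpha>)"
  have B: "B \<ge> 0" using assms by (simp add: B_def)
  have "pi * (1 - \<delta> \<alpha>) \<le> pi * 1" using d by (intro mult_left_mono) auto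
  then have tau: "\<bar>\<tau>\<bar> \<le> pi / 2" using assms(3) by linarith
  define g where "g = (\<lambda>z. exp (- (cis \<tau> * F \<alpha> z)))"
  have cos: "cos \<tau> \<ge> 0" using tau by (intro cos_ge_zero) auto
  have g_bound: "norm (g w) \<le> exp B" if "norm w \<le> 1" "w \<noteq> 1" for w
  proof -
    have "\<bar>sin \<tau> * Im (F \<alpha> w)\<bar> \<le> 1 * B"
      unfolding abs_mult B_def
      using abs_Im_F_le[OF assms(1) cball_subset_slit_plane[OF that]] by (intro mult_mono) auto
    moreover have "0 \<le> cos \<tau> * Re (F \<alpha> w)"
      using cos Re_F_pos[OF assms(1) that] by simp
    ultimately have "- Re (cis \<tau> * F \<alpha> w) \<le> B" by simp
    then show ?thesis by (simp add: g_def)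
  qed
  have g_circle: "norm (g w) \<le> 1" if "norm w = 1" "w \<noteq> 1" for w
  proof -
    have pos: "0 < Re (F \<alpha> w)" using Re_F_pos[OF assms(1)] that by simp
    have "\<bar>Arg (F \<alpha> w)\<bar> \<le> pi / 2 - \<bar>\<tau>\<bar>"
      using abs_Arg_F_circle_le[OF assms(1) that] assms(3) by (simp add: algebra_simps)
    then have "0 \<le> Re (cis \<tau> * F \<alpha> w)"
      using Re_cis_mult_nonneg_iff[OF pos, of "\<bar>\<tau>\<bar>"] tau by (cases "\<tau> \<ge> 0") simp_all
    then show ?thesis by (simp add: g_def)
  qed
  text \<open>The factor \<open>(1 - z) / 2\<close> removes the discontinuity of the bounded function \<open>g\<close> at \<open>1\<close>;
    it disappears after taking \<open>n\<close>-th roots.\<close>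
  have bound: "norm (g z) ^ n * norm ((1 - z) / 2) \<le> 1" for n
  proof -
    define h where "h = (\<lambda>z. if z = 1 then 0 else g z ^ n * ((1 - z) / 2))"
    have holg: "g holomorphic_on slit_plane"
      unfolding g_def by (intro holomorphic_intros F_holomorphic assms(1))
    have hol: "(\<lambda>z. g z ^ n * ((1 - z) / 2)) holomorphic_on slit_plane"
      by (intro holomorphic_intros holg) auto
    have not1: "1 \<notin> slit_plane" by (simp add: slit_plane_def)
    have holh: "h holomorphic_on slit_plane"
      by (rule holomorphic_transform[OF hol]) (use not1 in \<open>auto simp: h_def\<close>)
    have hb: "norm (h w) \<le> exp B ^ n * norm (1 - w)" if "norm w \<le> 1" for w
    proof (cases "w = 1")
      case False
      have "norm (h w) = norm (g w) ^ n * (norm (1 - w) / 2)"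
        using False by (simp add: h_def norm_mult norm_power norm_divide)
      also have "\<dots> \<le> exp B ^ n * norm (1 - w)"
        using g_bound[OF that False] by (intro mult_mono power_mono) auto
      finally show ?thesis .
    qed (simp add: h_def)
    have cont: "continuous_on (cball 0 1) h"
      unfolding continuous_on_eq_continuous_within
    proof
      fix w :: complex assume w: "w \<in> cball 0 1"
      show "continuous (at w within cball 0 1) h"
      proof (cases "w = 1")
        case False
        then have "w \<in> slit_plane" using w by (intro cball_subset_slit_plane) auto
        then have "isCont h w"
          using holomorphic_on_imp_continuous_on[OF holh] open_slit_plane continuous_on_eq_continuous_at
          by blast
        then show ?thesis by (rule continuous_at_imp_continuous_at_within)
      next
        case True
        have "((\<lambda>w::complex. exp B ^ n * norm (1 - w)) \<longlongrightarrow> exp B ^ n * norm (1 - 1 :: complex)) (at 1 within cball 0 1)"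
          by (intro tendsto_intros)
        then have lim: "((\<lambda>w::complex. exp B ^ n * norm (1 - w)) \<longlongrightarrow> 0) (at 1 within cball 0 1)" by simp
        have "(h \<longlongrightarrow> 0) (at 1 within cball 0 1)"
          by (rule Lim_null_comparison[OF _ lim])
             (use hb in \<open>auto simp: eventually_at_filter intro: eventuallyI\<close>)
        then show ?thesis by (simp add: True continuous_within h_def)
      qed
    qed
    have "norm (h z) \<le> 1"
    proof (rule maximum_modulus_frontier[of h "cball 0 1"])
      show "h holomorphic_on interior (cball 0 1)"
        using holomorphic_on_subset[OF holh disk_subset_slit_plane] by simp
      show "continuous_on (closure (cball 0 1)) h" using cont by simp
      show "norm (h w) \<le> 1" if "w \<in> frontier (cball 0 1)" for w
      proof (cases "w = 1")
        case False
        have n: "norm w = 1" using that by simp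
        have "norm (g w) ^ n \<le> 1 ^ n" using g_circle[OF n False] by (intro power_mono) auto
        moreover have "norm (1 - w) / 2 \<le> 1" using norm_triangle_ineq4[of 1 w] n by simp
        ultimately have "norm (g w) ^ n * (norm (1 - w) / 2) \<le> 1 * 1" by (intro mult_mono) auto
        then show ?thesis using False by (simp add: h_def norm_mult norm_power norm_divide)
      qed (simp add: h_def)
      show "z \<in> cball 0 1" using assms(2) by simp
    qed auto
    moreover have "z \<noteq> 1" using assms(2) by auto
    ultimately show ?thesis by (simp add: h_def norm_mult norm_power)
  qed
  have "norm (g z) \<le> 1"
  proof (rule ccontr)
    assume "\<not> norm (g z) \<le> 1"
    moreover have pos: "0 < norm ((1 - z) / 2)" using assms(2) by auto
    ultimately obtain n where "1 / norm ((1 - z) / 2) < norm (g z) ^ n"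
      using real_arch_pow by (meson not_le)
    then have "1 < norm (g z) ^ n * norm ((1 - z) / 2)" using pos by (simp only: divide_less_eq if_True)
    with bound[of n] show False by simp
  qed
  then show ?thesis by (simp add: g_def)
qed

section \<open>Averages of rotations of F\<close>

lemma circle_mean_value:
  assumes "continuous_on (cball 0 1) Q" "Q holomorphic_on \<bbbD>" "z \<in> \<bbbD>"
  shows "((\<lambda>t. Q (cis (2 * pi * t)) * (cis (2 * pi * t) / (cis (2 * pi * t) - z))) has_integral Q z) {0..1}"
proof -
  have "((\<lambda>u. Q u / (u - z)) has_contour_integral (2 * of_real pi * \<i> * Q z)) (circlepath 0 1)"
    using assms by (intro Cauchy_integral_circlepath) auto
  then have "((\<lambda>t. Q (cis (2 * pi * t)) / (cis (2 * pi * t) - z) * (2 * of_real pi * \<i> * cis (2 * pi * t)))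
               has_integral (2 * of_real pi * \<i> * Q z)) {0..1}"
    unfolding has_contour_integral vector_derivative_circlepath
    by (simp add: circlepath cis_conv_exp mult_ac)
  from has_integral_mult_right[OF this, of "1 / (2 * of_real pi * \<i>)"]
  show ?thesis by (simp add: field_simps)
qed

text \<open>By Cauchy's formula, \<open>Q\<close> times the kernel has mean 2 Q(z) - 1 (fact
  \<open>A\<close>). The conjugate of \<open>Q\<close> times the kernel is the conjugate of
  \<open>?G\<close>, which is holomorphic, so its mean is the value 1 at the centre (fact
  \<open>B\<close>). Half the sum replaces \<open>Q\<close> by its real part.\<close>

lemma schwarz_integral_formula:
  assumes "continuous_on (cball 0 1) Q" "Q holomorphic_on \<bbbD>" "Q 0 = 1" "z \<in> \<bbbD>"
  shows "((\<lambda>t. of_real (Re (Q (cis (2 * pi * t)))) * cayley (z * cnj (cis (2 * pi * t)))) has_integral Q z) {0..1}"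
proof -
  let ?e = "\<lambda>t. cis (2 * pi * t)"
  have ne: "?e t - z \<noteq> 0" for t using assms(4) by (metis eq_iff_diff_eq_0 less_irrefl mem_ball_0 norm_cis)
  have cay: "cayley (z * cnj (?e t)) = 2 * (?e t / (?e t - z)) - 1" for t
  proof -
    have "cnj (?e t) = 1 / ?e t" by (simp add: cis_cnj divide_inverse)
    moreover have "1 + z * (1 / ?e t) = (?e t + z) / ?e t" "1 - z * (1 / ?e t) = (?e t - z) / ?e t"
      by (simp_all add: add_divide_distrib diff_divide_distrib)
    ultimately have "cayley (z * cnj (?e t)) = (2 * ?e t - (?e t - z)) / (?e t - z)"
      by (simp add: cayley_def)
    also have "\<dots> = 2 * ?e t / (?e t - z) - (?e t - z) / (?e t - z)"
      by (rule diff_divide_distrib)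
    finally show ?thesis
      using ne[of t] by simp
  qed
  have I1: "((\<lambda>t. Q (?e t) * (?e t / (?e t - z))) has_integral Q z) {0..1}"
    by (intro circle_mean_value assms)
  have I0: "((\<lambda>t. Q (?e t)) has_integral 1) {0..1}"
    using circle_mean_value[of Q 0] assms by simp
  have A: "((\<lambda>t. Q (?e t) * cayley (z * cnj (?e t))) has_integral 2 * Q z - 1) {0..1}"
  proof -
    have "Q (?e t) * cayley (z * cnj (?e t)) = 2 * (Q (?e t) * (?e t / (?e t - z))) - Q (?e t)" for t
      unfolding cay by (simp add: right_diff_distrib)
    then show ?thesis
      using has_integral_diff[OF has_integral_mult_right[OF I1, of 2] I0] by (simp only:)
  qed
  let ?G = "\<lambda>w. Q w * cayley (cnj z * w)"
  have ne': "1 - cnj z * w \<noteq> 0" if "norm w \<le> 1" for w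
  proof -
    have "norm (cnj z * w) \<le> norm z * 1" unfolding norm_mult using that by (intro mult_mono) auto
    then show ?thesis using assms(4) by auto
  qed
  have "((\<lambda>t. ?G (?e t) * (?e t / (?e t - 0))) has_integral ?G 0) {0..1}"
    unfolding cayley_def
    using ne' assms
    by (intro circle_mean_value) (auto intro!: continuous_intros holomorphic_intros)
  then have G1: "((\<lambda>t. ?G (?e t)) has_integral 1) {0..1}"
    using assms(3) by (simp add: cayley_def)
  have "((\<lambda>t. cnj (?G (?e t))) has_integral cnj 1) {0..1}"
    using has_integral_cnj[THEN iffD2, OF G1] by (simp add: o_def)
  moreover have C: "cnj (?G w) = cnj (Q w) * cayley (z * cnj w)" for w
    by (simp add: cayley_def)
  ultimately have B: "((\<lambda>t. cnj (Q (?e t)) * cayley (z * cnj (?e t))) has_integral 1) {0..1}"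
    by (simp only: C complex_cnj_one)
  from has_integral_mult_right[OF has_integral_add[OF A B], of "1 / 2"]
  have "((\<lambda>t. 1 / 2 * ((Q (?e t) + cnj (Q (?e t))) * cayley (z * cnj (?e t)))) has_integral Q z) {0..1}"
    by (simp add: algebra_simps)
  then show ?thesis
    unfolding complex_add_cnj by simp
qed

lemma has_integral_powr_scaled:
  assumes "\<alpha> < 1" "p holomorphic_on \<bbbD>" "z \<in> \<bbbD>"
  shows "((\<lambda>t. p (of_real (t powr (1 - \<alpha>)) * z) +
      of_real (1 - \<alpha>) * (of_real (t powr (1 - \<alpha>)) * z * deriv p (of_real (t powr (1 - \<alpha>)) * z)))
     has_integral p z) {0..1}"
proof -
  let ?s = "\<lambda>t. complex_of_real (t powr (1 - \<alpha>))"
  have mem: "?s t * z \<in> \<bbbD>" if "t \<in> {0..1}" for t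
  proof -
    have "norm (?s t * z) \<le> 1 * norm z"
      unfolding norm_mult using powr_in_unit_interval[OF assms(1) that] by (intro mult_right_mono) auto
    then show ?thesis using assms(3) by simp
  qed
  have "((\<lambda>t. p (?s t * z) + of_real (1 - \<alpha>) * (?s t * z * deriv p (?s t * z)))
     has_integral (of_real 1 * p (?s 1 * z) - of_real 0 * p (?s 0 * z))) {0..1}"
  proof (rule fundamental_theorem_of_calculus_interior)
    have "continuous_on {0..1} (\<lambda>t. p (?s t * z))"
    proof (rule continuous_on_compose2[OF holomorphic_on_imp_continuous_on[OF assms(2)]])
      show "continuous_on {0..1} (\<lambda>t. ?s t * z)"
        by (intro continuous_intros continuous_on_powr_unit assms)
      show "(\<lambda>t. ?s t * z) ` {0..1} \<subseteq> \<bbbD>" using mem by blast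
    qed
    then show "continuous_on {0..1} (\<lambda>t. of_real t * p (?s t * z))"
      by (intro continuous_intros)
    show "((\<lambda>t. of_real t * p (?s t * z)) has_vector_derivative
        p (?s t * z) + of_real (1 - \<alpha>) * (?s t * z * deriv p (?s t * z))) (at t)"
      if "t \<in> {0<..<1}" for t
      using that mem[of t] assms(2)
      by (intro has_vector_derivative_mult_powr holomorphic_derivI[OF assms(2)]) auto
  qed auto
  then show ?thesis by simp
qed

text \<open>\<open>q\<close> need not extend to the unit circle, so the Schwarz formula is applied
  to its dilation \<open>Q\<close> by r < 1. Inserting it into
  \<open>has_integral_powr_scaled\<close> and exchanging the integrals leaves a mean of Cayley
  kernels, which is \<open>F \<alpha>\<close>.\<close>

lemma has_integral_F_representation:
  assumes "\<alpha> < 1" "p holomorphic_on \<bbbD>" "p 0 = 1" "0 < r" "r < 1" "w \<in> \<bbbD>"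
  defines "q \<equiv> \<lambda>z. p z + of_real (1 - \<alpha>) * (z * deriv p z)"
  shows "((\<lambda>t. of_real (Re (q (of_real r * cis (2 * pi * t)))) * F \<alpha> (w * cnj (cis (2 * pi * t))))
           has_integral p (of_real r * w)) {0..1}"
proof -
  let ?s = "\<lambda>t. complex_of_real (t powr (1 - \<alpha>))"
  let ?e = "\<lambda>t. cis (2 * pi * t)"
  define Q where "Q = (\<lambda>z. q (of_real r * z))"
  have holq: "q holomorphic_on \<bbbD>"
    unfolding q_def by (intro holomorphic_intros assms) auto
  have mem: "of_real r * z \<in> \<bbbD>" if "norm z \<le> 1" for z
  proof -
    have "r * norm z \<le> r * 1" using that assms by (intro mult_left_mono) auto
    also have "r * norm z = norm (of_real r * z)" using assms(4) by (simp add: norm_mult)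
    finally show ?thesis using assms(5) by simp
  qed
  have contQ: "continuous_on (cball 0 1) Q"
    unfolding Q_def
    by (rule continuous_on_compose2[OF holomorphic_on_imp_continuous_on[OF holq]])
       (use mem in \<open>auto intro!: continuous_intros\<close>)
  have holQ: "Q holomorphic_on \<bbbD>"
    unfolding Q_def
    by (rule holomorphic_on_compose_gen[OF _ holq, unfolded o_def])
       (use mem in \<open>auto intro!: holomorphic_intros\<close>)
  have Q0: "Q 0 = 1" by (simp add: Q_def q_def assms)
  define f where "f = (\<lambda>x y. of_real (Re (Q (?e y))) * cayley (?s x * (w * cnj (?e y))))"
  have wmem: "w * cnj (?e y) \<in> \<bbbD>" for y using assms(6) by (simp add: norm_mult)
  have contReQ: "continuous_on T (\<lambda>t. complex_of_real (Re (Q (?e (g t)))))" if "continuous_on T g" for g :: "'a::topological_space \<Rightarrow> real" and T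
  proof (intro continuous_intros)
    have "continuous_on T (\<lambda>t. ?e (g t))" unfolding cis_conv_exp by (intro continuous_intros that)
    then show "continuous_on T (\<lambda>t. Q (?e (g t)))"
      by (rule continuous_on_compose2[OF contQ]) auto
  qed
  have "integral (cbox 0 1) (\<lambda>x. integral (cbox 0 1) (f x)) = integral (cbox 0 1) (\<lambda>y. integral (cbox 0 1) (\<lambda>x. f x y))"
  proof (rule integral_swap_continuous)
    let ?C = "cbox (0, 0) (1, 1) :: (real \<times> real) set"
    have c1: "continuous_on ?C (\<lambda>x. fst x powr (1 - \<alpha>))"
      using assms(1) by (intro continuous_on_powr' continuous_intros) (auto simp: cbox_Pair_eq)
    have c2: "continuous_on ?C (\<lambda>x. cnj (?e (snd x)))"
      unfolding cis_conv_exp by (intro continuous_intros)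
    have ne: "1 - ?s (fst x) * (w * cnj (?e (snd x))) \<noteq> 0" if "x \<in> ?C" for x
    proof -
      have "fst x \<in> {0..1}" using that by (auto simp: cbox_Pair_eq)
      from slit_plane_scaled_ne_1[OF _ powr_in_unit_interval[OF assms(1) this], of "w * cnj (?e (snd x))"]
      have "?s (fst x) * (w * cnj (?e (snd x))) \<noteq> 1" using disk_subset_slit_plane wmem by blast
      then show ?thesis by simp
    qed
    show "continuous_on ?C (\<lambda>(x, y). f x y)"
      unfolding case_prod_unfold f_def cayley_def
      by (intro continuous_on_mult continuous_on_divide continuous_on_add continuous_on_diff
          continuous_on_const continuous_on_of_real contReQ c1 c2 continuous_on_snd continuous_on_id ballI ne)
  qed
  moreover have "integral (cbox 0 1) (f x) = q (?s x * (of_real r * w))" if "x \<in> {0..1}" for x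
  proof -
    have "norm (?s x * w) \<le> 1 * norm w"
      unfolding norm_mult using powr_in_unit_interval[OF assms(1) that] by (intro mult_right_mono) auto
    then have "?s x * w \<in> \<bbbD>" using assms(6) by simp
    from schwarz_integral_formula[OF contQ holQ Q0 this]
    have "(f x has_integral Q (?s x * w)) {0..1}" unfolding f_def by (simp add: mult.assoc)
    then have "integral (cbox 0 1) (f x) = Q (?s x * w)" by (simp add: integral_unique)
    then show ?thesis by (simp add: Q_def mult_ac)
  qed
  then have "integral (cbox 0 1) (\<lambda>x. integral (cbox 0 1) (f x)) = integral (cbox 0 1) (\<lambda>x. q (?s x * (of_real r * w)))"
    by (intro integral_cong) auto
  also have "\<dots> = p (of_real r * w)"
    unfolding q_def cbox_interval using has_integral_powr_scaled[OF assms(1,2) mem[of w]] assms(6) by (auto intro: integral_unique)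
  moreover have "integral (cbox 0 1) (\<lambda>x. f x y) = of_real (Re (Q (?e y))) * F \<alpha> (w * cnj (?e y))" for y
    using integral_mult_right[of "{0..1}" "of_real (Re (Q (?e y)))" "\<lambda>x. cayley (?s x * (w * cnj (?e y)))"]
    unfolding f_def F_eq_integral_cayley by simp
  ultimately have "integral {0..1} (\<lambda>y. of_real (Re (Q (?e y))) * F \<alpha> (w * cnj (?e y))) = p (of_real r * w)"
    by simp
  moreover have "(\<lambda>y. of_real (Re (Q (?e y))) * F \<alpha> (w * cnj (?e y))) integrable_on {0..1}"
  proof (intro integrable_continuous_interval continuous_on_mult contReQ continuous_on_id)
    have "continuous_on {0..1} (\<lambda>y. w * cnj (?e y))"
      unfolding cis_conv_exp by (intro continuous_intros)
    then show "continuous_on {0..1} (\<lambda>y. F \<alpha> (w * cnj (?e y)))"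
      by (rule continuous_on_compose2[OF holomorphic_on_imp_continuous_on[OF F_holomorphic[OF assms(1)]]])
         (use wmem disk_subset_slit_plane in auto)
  qed
  ultimately show ?thesis unfolding Q_def has_integral_iff by simp
qed

text \<open>The weights Re q are nonnegative with total mass 1, so \<open>p z\<close> is an average
  of values of \<open>F \<alpha>\<close> on the disk and stays in every closed half-plane containing
  them. It serves with \<gamma> = 1 for the squeezing and with unimodular \<gamma> and c = 0 for the
  sector.\<close>

lemma Re_mult_ge_of_F:
  assumes "\<alpha> < 1" "p holomorphic_on \<bbbD>" "p 0 = 1"
    and q: "\<And>z. z \<in> \<bbbD> \<Longrightarrow> 0 \<le> Re (p z + of_real (1 - \<alpha>) * (z * deriv p z))"
    and c: "\<And>z. z \<in> \<bbbD> \<Longrightarrow> c \<le> Re (\<gamma> * F \<alpha> z)"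
    and "z \<in> \<bbbD>"
  shows "c \<le> Re (\<gamma> * p z)"
proof -
  obtain r where r: "norm z < r" "r < 1" using assms(6) dense by auto
  then have r0: "0 < r" using norm_ge_zero[of z] by linarith
  define w where "w = z / of_real r"
  have w: "w \<in> \<bbbD>" using r r0 by (simp add: w_def norm_divide)
  have z: "z = of_real r * w" using r0 by (simp add: w_def)
  let ?e = "\<lambda>t. cis (2 * pi * t)"
  define q where "q = (\<lambda>z. p z + of_real (1 - \<alpha>) * (z * deriv p z))"
  note rep = has_integral_F_representation[OF assms(1-3) r0 r(2)]
  \<comment> \<open>The total mass is read off from the representation at w = 0, where both
    \<open>F \<alpha>\<close> and \<open>p\<close> are 1.\<close>
  have "((\<lambda>t. Re (q (of_real r * ?e t))) has_integral 1) {0..1}"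
    using has_integral_Re[OF rep[of 0]] by (simp add: q_def F_0[OF assms(1)] assms(3))
  from has_integral_mult_left[OF this, of c]
  have "((\<lambda>t. Re (q (of_real r * ?e t)) * c) has_integral c) {0..1}" by simp
  moreover have "((\<lambda>t. Re (\<gamma> * (of_real (Re (q (of_real r * ?e t))) * F \<alpha> (w * cnj (?e t))))) has_integral Re (\<gamma> * p z)) {0..1}"
    unfolding z q_def by (intro has_integral_Re has_integral_mult_right rep w)
  ultimately show ?thesis
  proof (rule has_integral_le)
    fix t :: real
    have "of_real r * ?e t \<in> \<bbbD>" using r r0 by (simp add: norm_mult)
    then have "0 \<le> Re (q (of_real r * ?e t))" unfolding q_def by (rule q)
    moreover have "c \<le> Re (\<gamma> * F \<alpha> (w * cnj (?e t)))" using w by (intro c) (simp add: norm_mult)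
    ultimately have "Re (q (of_real r * ?e t)) * c \<le> Re (q (of_real r * ?e t)) * Re (\<gamma> * F \<alpha> (w * cnj (?e t)))"
      by (intro mult_left_mono)
    also have "\<dots> = Re (of_real (Re (q (of_real r * ?e t))) * (\<gamma> * F \<alpha> (w * cnj (?e t))))"
      by simp
    finally show "Re (q (of_real r * ?e t)) * c \<le> Re (\<gamma> * (of_real (Re (q (of_real r * ?e t))) * F \<alpha> (w * cnj (?e t))))"
      by (simp only: mult.left_commute)
  qed
qed

section \<open>Comparison of the two sector constants\<close>

text \<open>The left side is strictly increasing in x. So the root given by the intermediate value
  theorem is unique, which makes \<open>THE\<close> denote it, and a value of at most pi / 2 places
  x at or below this root.\<close>

lemma le_sector_bound:
  assumes "\<alpha> < 1" and x: "pi * x / 2 + arctan ((1 - \<alpha>) * x) \<le> pi / 2"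
  shows "x \<le> \<b> \<alpha>"
proof -
  let ?B = "\<lambda>b. pi * b / 2 + arctan ((1 - \<alpha>) * b)"
  have mono: "?B y < ?B y'" if "y < y'" for y y'
    using that assms(1) by (intro add_strict_mono) (auto simp: arctan_less_iff)
  have "\<exists>b. 0 \<le> b \<and> b \<le> 1 \<and> ?B b = pi / 2"
  proof (rule IVT')
    show "?B 0 \<le> pi / 2" by simp
    show "pi / 2 \<le> ?B 1" using assms(1) by (simp add: zero_le_arctan_iff)
    show "continuous_on {0..1} ?B" by (intro continuous_intros) auto
  qed simp
  then obtain b where b: "0 \<le> b" "b \<le> 1" "?B b = pi / 2" by blast
  have "\<b> \<alpha> = b"
    unfolding sector_bound_def
  proof (rule the_equality)
    fix b' assume b': "0 \<le> b' \<and> b' \<le> 1 \<and> ?B b' = pi / 2"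
    show "b' = b"
    proof (rule ccontr)
      assume "b' \<noteq> b"
      then show False
        using mono[of b b'] mono[of b' b] b b' by (cases "b < b'") auto
    qed
  qed (use b in auto)
  moreover have "x \<le> b"
  proof (rule ccontr)
    assume "\<not> x \<le> b"
    then show False using mono[of b x] b x by simp
  qed
  ultimately show ?thesis by simp
qed

lemma abs_Arg_F_disk_le:
  assumes "\<alpha> < 1" "z \<in> \<bbbD>"
  shows "\<bar>Arg (F \<alpha> z)\<bar> \<le> pi * \<delta> \<alpha> / 2"
proof -
  have d: "0 < \<delta> \<alpha>" "\<delta> \<alpha> < 1" using sector_const_attained[OF assms(1)] by metis+
  define A where "A = pi * (1 - \<delta> \<alpha>) / 2"
  have A: "0 \<le> A" "pi / 2 - A = pi * \<delta> \<alpha> / 2" using d by (simp_all add: A_def right_diff_distrib diff_divide_distrib)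
  have "pi * \<delta> \<alpha> / 2 \<ge> 0" using d by simp
  then have A2: "A \<le> pi / 2" using A(2) by linarith
  have "0 < Re (F \<alpha> z)" by (rule Re_F_pos[OF assms(1)]) (use assms(2) in auto)
  from Re_cis_mult_nonneg_iff[OF this A(1) A2]
  show ?thesis
    using Re_cis_F_nonneg[OF assms, of A] Re_cis_F_nonneg[OF assms, of "- A"] A by (simp add: A_def)
qed

text \<open>P = exp (v z) lies in the right half-plane and is 1 at z = 0, so the Schwarz lemma
  applies to its Cayley image \<open>w\<close>: |P - 1|^2 \<le> |z|^2 |P + 1|^2. Expanding this and
  using 2 \<rho> \<le> \<rho>^2 + 1 for \<rho> = |P| leaves a bound on the angle alone.\<close>

lemma cos_Im_lower_bound:
  assumes "v holomorphic_on \<bbbD>" "v 0 = 0" "\<And>z. z \<in> \<bbbD> \<Longrightarrow> \<bar>Im (v z)\<bar> < pi / 2" "z \<in> \<bbbD>"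
  shows "(1 - (norm z)\<^sup>2) / (1 + (norm z)\<^sup>2) \<le> cos (Im (v z))"
proof -
  define w where "w = (\<lambda>z. (exp (v z) - 1) / (exp (v z) + 1))"
  have pos: "0 < Re (exp (v z))" if "z \<in> \<bbbD>" for z
    using assms(3)[OF that] by (simp add: Re_exp cos_gt_zero_pi abs_less_iff)
  have ne: "exp (v z) + 1 \<noteq> 0" if "z \<in> \<bbbD>" for z
    using pos[OF that] by (auto simp: complex_eq_iff)
  have sq: "(norm (P + 1))\<^sup>2 - (norm (P - 1))\<^sup>2 = 4 * Re P" for P :: complex
    unfolding cmod_power2 by (simp add: power2_eq_square algebra_simps)
  have "norm (w z) \<le> norm z"
  proof (rule Schwarz_Lemma(1))
    show "w holomorphic_on \<bbbD>" unfolding w_def using ne assms(1) by (intro holomorphic_intros) auto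
    show "w 0 = 0" by (simp add: w_def assms)
    show "norm (w z) < 1" if "norm z < 1" for z
    proof -
      have z: "z \<in> \<bbbD>" using that by simp
      have "(norm (exp (v z) - 1))\<^sup>2 < (norm (exp (v z) + 1))\<^sup>2"
        using sq[of "exp (v z)"] pos[OF z] by simp
      then have "norm (exp (v z) - 1) < norm (exp (v z) + 1)"
        by (rule power_less_imp_less_base) simp
      then show ?thesis using ne[OF z] by (simp add: w_def norm_divide)
    qed
  qed (use assms(4) in simp)
  then have "norm (exp (v z) - 1) \<le> norm z * norm (exp (v z) + 1)"
    using ne[OF assms(4)] by (simp add: w_def norm_divide field_simps)
  then have "(norm (exp (v z) - 1))\<^sup>2 \<le> (norm z * norm (exp (v z) + 1))\<^sup>2"
    by (intro power_mono) auto
  then have *: "(norm (exp (v z) - 1))\<^sup>2 \<le> (norm z)\<^sup>2 * (norm (exp (v z) + 1))\<^sup>2"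
    by (simp add: power_mult_distrib)
  define \<rho> where "\<rho> = exp (Re (v z))"
  define c where "c = cos (Im (v z))"
  define R where "R = (norm z)\<^sup>2"
  have \<rho>: "\<rho> > 0" by (simp add: \<rho>_def)
  have R: "0 \<le> R" "R \<le> 1" using assms(4) by (auto simp: R_def power_le_one)
  have n: "(norm (exp (v z)))\<^sup>2 = \<rho>\<^sup>2" "Re (exp (v z)) = \<rho> * c" by (simp_all add: \<rho>_def c_def Re_exp)
  have pm: "(norm (P - 1))\<^sup>2 = (norm P)\<^sup>2 + 1 - 2 * Re P" "(norm (P + 1))\<^sup>2 = (norm P)\<^sup>2 + 1 + 2 * Re P" for P :: complex
    unfolding cmod_power2 by (simp_all add: power2_eq_square algebra_simps)
  have "\<rho>\<^sup>2 + 1 - 2 * (\<rho> * c) \<le> R * (\<rho>\<^sup>2 + 1 + 2 * (\<rho> * c))"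
    using * unfolding pm n R_def .
  then have "(1 - R) * (\<rho>\<^sup>2 + 1) \<le> 2 * \<rho> * (c * (1 + R))" by (simp add: algebra_simps)
  moreover have "2 * \<rho> \<le> \<rho>\<^sup>2 + 1" using zero_le_power2[of "\<rho> - 1"] by (simp add: power2_diff)
  then have "(1 - R) * (2 * \<rho>) \<le> (1 - R) * (\<rho>\<^sup>2 + 1)" using R by (intro mult_left_mono) auto
  ultimately have "2 * \<rho> * (1 - R) \<le> 2 * \<rho> * (c * (1 + R))" by (simp only: mult.commute[of "1 - R" "2 * \<rho>"])
  then have "1 - R \<le> c * (1 + R)" using \<rho> by simp
  then show ?thesis using R unfolding R_def[symmetric] c_def[symmetric] by (simp add: pos_divide_le_eq)
qed

text \<open>At the maximum point \<open>z0\<close> the tangential derivative of Arg F vanishes, so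
  z0 F' / F = i k, where k is the radial derivative of Arg F. The bound
  \<open>cos_Im_lower_bound\<close> for Ln F / d forces d \<le> k. The differential equation equates
  F (1 + (1 - \<alpha>) i k) with the purely imaginary \<open>cayley z0\<close>, whence Re F / Im F
  = (1 - \<alpha>) k, that is, cot (pi d / 2) \<ge> (1 - \<alpha>) d.\<close>

lemma sector_const_le_sector_bound:
  assumes "\<alpha> < 1"
  shows "\<delta> \<alpha> \<le> \<b> \<alpha>"
proof -
  define d where "d = \<delta> \<alpha>"
  obtain \<theta>0 where th: "0 < \<theta>0" "\<theta>0 < pi" "Arg (F \<alpha> (cis \<theta>0)) = pi * d / 2"
    "\<And>\<theta>. 0 < \<theta> \<Longrightarrow> \<theta> < pi \<Longrightarrow> Arg (F \<alpha> (cis \<theta>)) \<le> pi * d / 2"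
    and d: "0 < d" "d < 1"
    using sector_const_attained[OF assms] unfolding d_def by metis
  define z0 where "z0 = cis \<theta>0"
  have z0: "norm z0 = 1" "z0 \<in> slit_plane" "z0 \<noteq> 1"
    using cis_in_slit_plane[of \<theta>0] cis_ne_1[of \<theta>0] th by (auto simp: z0_def)
  define L where "L = (\<lambda>z. Ln (F \<alpha> z))"
  have Im_L: "Im (L z) = Arg (F \<alpha> z)" if "norm z \<le> 1" "z \<noteq> 1" for z
    using Re_F_pos[OF assms that] by (metis Arg_eq_Im_Ln L_def less_irrefl zero_complex.simps(1))
  have nonpos: "F \<alpha> z \<notin> \<real>\<^sub>\<le>\<^sub>0" if "norm z \<le> 1" "z \<noteq> 1" for z
    using Re_F_pos[OF assms that] by (auto simp: complex_nonpos_Reals_iff)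
  have holL: "L holomorphic_on \<bbbD>"
    unfolding L_def
    by (intro holomorphic_intros holomorphic_on_subset[OF F_holomorphic[OF assms] disk_subset_slit_plane] nonpos) auto
  have cos_ge: "(1 - (norm z)\<^sup>2) / (1 + (norm z)\<^sup>2) \<le> cos (Im (L z) / d)" if z: "z \<in> \<bbbD>" for z
  proof -
    text \<open>The bound \<open>\<bar>Im (L z) / d\<bar> \<le> pi / 2\<close> is not known to be strict, hence the detour via \<open>d' > d\<close>.\<close>
    have "((\<lambda>d'. cos (Im (L z) / d')) \<longlongrightarrow> cos (Im (L z) / d)) (at_right d)"
      using d by (intro tendsto_intros) auto
    moreover have "\<forall>\<^sub>F d' in at_right d. (1 - (norm z)\<^sup>2) / (1 + (norm z)\<^sup>2) \<le> cos (Im (L z) / d')"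
    proof (rule eventually_at_rightI[of d "d + 1"])
      fix d' assume "d' \<in> {d<..<d + 1}"
      then have d': "d < d'" "0 < d'" using d by auto
      have "(1 - (norm z)\<^sup>2) / (1 + (norm z)\<^sup>2) \<le> cos (Im (L z / of_real d'))"
      proof (rule cos_Im_lower_bound[OF _ _ _ z])
        show "(\<lambda>z. L z / of_real d') holomorphic_on \<bbbD>"
          using d' by (intro holomorphic_intros holL) auto
        show "L 0 / of_real d' = 0" by (simp add: L_def F_0[OF assms])
        show "\<bar>Im (L w / of_real d')\<bar> < pi / 2" if w: "w \<in> \<bbbD>" for w
        proof -
          have "\<bar>Im (L w)\<bar> \<le> pi * d / 2"
          proof -
            have "norm w \<le> 1" "w \<noteq> 1" using w by auto
            then show ?thesis using abs_Arg_F_disk_le[OF assms w] by (simp add: Im_L d_def)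
          qed
          also have "\<dots> < pi * d' / 2" using d' by simp
          finally show ?thesis using d' by (simp add: field_simps)
        qed
      qed
      then show "(1 - (norm z)\<^sup>2) / (1 + (norm z)\<^sup>2) \<le> cos (Im (L z) / d')" by simp
    qed auto
    ultimately show ?thesis by (intro tendsto_lowerbound) auto
  qed
  define F' where "F' = deriv (F \<alpha>) z0"
  have Fz0: "0 < Re (F \<alpha> z0)" "0 < Im (F \<alpha> z0)"
    using Re_F_pos[OF assms, of z0] z0 Im_F_bounds_upper(1)[OF assms, of z0] th
    by (auto simp: z0_def sin_gt_zero)
  have derF: "(F \<alpha> has_field_derivative F') (at z0)"
    unfolding F'_def using F_holomorphic[OF assms] open_slit_plane z0(2) by (rule holomorphic_derivI)
  have derL: "(L has_field_derivative F' / F \<alpha> z0) (at z0)"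
    unfolding L_def using nonpos[of z0] z0
    by (auto intro!: derivative_eq_intros derF simp: divide_inverse mult.commute)
  define k where "k = Im (z0 * (F' / F \<alpha> z0))"
  \<comment> \<open>Since Im (i x) = Re x, this real part is the derivative of the angle along the
    circle.\<close>
  have "Re (z0 * (F' / F \<alpha> z0)) = 0"
  proof -
    have "(cis has_vector_derivative \<i> * z0) (at \<theta>0)"
      unfolding has_vector_derivative_def
      by (auto intro!: derivative_eq_intros simp: z0_def)
    from field_vector_diff_chain_at[OF this, of L "F' / F \<alpha> z0"] derL
    have "((L \<circ> cis) has_vector_derivative \<i> * z0 * (F' / F \<alpha> z0)) (at \<theta>0)"
      by (simp add: z0_def)
    from bounded_linear.has_vector_derivative[OF bounded_linear_Im this]
    have der: "((\<lambda>\<theta>. Im (L (cis \<theta>))) has_real_derivative Re (z0 * (F' / F \<alpha> z0))) (at \<theta>0)"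
      by (simp only: has_real_derivative_iff_has_vector_derivative o_def mult.assoc Im_i_times)
    show ?thesis
    proof (rule DERIV_local_max[OF der])
      show "0 < min \<theta>0 (pi - \<theta>0)" using th by simp
      show "\<forall>y. \<bar>\<theta>0 - y\<bar> < min \<theta>0 (pi - \<theta>0) \<longrightarrow> Im (L (cis y)) \<le> Im (L (cis \<theta>0))"
      proof (intro allI impI)
        fix y assume y: "\<bar>\<theta>0 - y\<bar> < min \<theta>0 (pi - \<theta>0)"
        then have y': "0 < y" "y < pi" by auto
        have "Arg (F \<alpha> (cis y)) \<le> Arg (F \<alpha> (cis \<theta>0))"
          using th(4)[OF y'] unfolding th(3) .
        then show "Im (L (cis y)) \<le> Im (L (cis \<theta>0))"
          using Im_L[of "cis y"] Im_L[of "cis \<theta>0"] cis_ne_1[of y] cis_ne_1[of \<theta>0] y' th(1,2) by simp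
      qed
    qed
  qed
  then have zF: "z0 * (F' / F \<alpha> z0) = \<i> * of_real k"
    by (simp add: complex_eq_iff k_def)
  have "d \<le> k"
  proof (rule ccontr)
    assume "\<not> d \<le> k"
    \<comment> \<open>\<open>H\<close> is nonnegative on [0, 1) and 0 at 1, where the scaled angle
      is pi / 2. Its derivative at 1 is 1 - k / d, so k < d would make it negative just left of
      1.\<close>
    define H where "H = (\<lambda>r::real. cos (Im (L (of_real r * z0)) / d) - (1 - r\<^sup>2) / (1 + r\<^sup>2))"
    have "((\<lambda>r. of_real r * z0) has_vector_derivative z0) (at (1::real))"
      by (auto intro!: derivative_eq_intros)
    from field_vector_diff_chain_at[OF this, of L "F' / F \<alpha> z0"] derL
    have "((L \<circ> (\<lambda>r. of_real r * z0)) has_vector_derivative z0 * (F' / F \<alpha> z0)) (at (1::real))" by simp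
    from bounded_linear.has_vector_derivative[OF bounded_linear_Im this]
    have der: "((\<lambda>r. Im (L (of_real r * z0))) has_real_derivative k) (at 1)"
      by (simp add: has_real_derivative_iff_has_vector_derivative o_def k_def)
    have at1: "Im (L (of_real 1 * z0)) / d = pi / 2"
      using Im_L[of z0] z0 th d by (simp add: z0_def)
    have "((\<lambda>r. Im (L (of_real r * z0)) / d) has_real_derivative k / d) (at 1)"
      using der by (rule DERIV_cdivide)
    from DERIV_chain2[OF DERIV_cos this]
    have "((\<lambda>r. cos (Im (L (of_real r * z0)) / d)) has_real_derivative - (k / d)) (at 1)"
      unfolding at1 by simp
    moreover have "((\<lambda>r::real. (1 - r\<^sup>2) / (1 + r\<^sup>2)) has_real_derivative - 1) (at 1)"
      by (auto intro!: derivative_eq_intros)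
    ultimately have "(H has_real_derivative - (k / d) - (- 1)) (at 1)"
      unfolding H_def by (rule DERIV_diff)
    moreover have "0 < - (k / d) - (- 1)" using \<open>\<not> d \<le> k\<close> d by simp
    ultimately obtain e where e: "0 < e" "\<And>h. 0 < h \<Longrightarrow> h < e \<Longrightarrow> H (1 - h) < H 1"
      using DERIV_pos_inc_left by metis
    define h where "h = min (e / 2) (1 / 2)"
    have h: "0 < h" "h < e" "h < 1" using e by (auto simp: h_def min_def)
    have "H 1 = 0" unfolding H_def at1 by simp
    moreover have "0 \<le> H (1 - h)"
    proof -
      have "norm (of_real (1 - h) * z0) = 1 - h" using h z0(1) norm_of_real[of "1 - h", where 'a = complex] by (simp only: norm_mult) simp
      then show ?thesis using cos_ge[of "of_real (1 - h) * z0"] h unfolding H_def by simp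
    qed
    ultimately show False using e(2)[of h] h by simp
  qed
  have "F \<alpha> z0 * (1 + of_real (1 - \<alpha>) * (\<i> * of_real k)) = cayley z0"
  proof -
    have "F \<alpha> z0 \<noteq> 0" using Fz0 by auto
    then have "F \<alpha> z0 * (1 + of_real (1 - \<alpha>) * (z0 * (F' / F \<alpha> z0))) = F \<alpha> z0 + of_real (1 - \<alpha>) * (z0 * F')"
      by (simp add: field_simps)
    then show ?thesis
      using F_differential_equation[OF assms z0(2)] unfolding zF F'_def[symmetric] by simp
  qed
  moreover have "Re (cayley z0) = 0" by (simp add: Re_cayley z0)
  ultimately have "Re (F \<alpha> z0 * (1 + of_real (1 - \<alpha>) * (\<i> * of_real k))) = 0" by simp
  then have "Re (F \<alpha> z0) = (1 - \<alpha>) * k * Im (F \<alpha> z0)" by (simp add: algebra_simps)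
  moreover have "(1 - \<alpha>) * d * Im (F \<alpha> z0) \<le> (1 - \<alpha>) * k * Im (F \<alpha> z0)"
    using \<open>d \<le> k\<close> assms Fz0 by (intro mult_right_mono mult_left_mono) auto
  ultimately have "(1 - \<alpha>) * d \<le> 1 / (Im (F \<alpha> z0) / Re (F \<alpha> z0))"
    using Fz0 by (simp add: field_simps)
  then have "arctan ((1 - \<alpha>) * d) \<le> arctan (1 / (Im (F \<alpha> z0) / Re (F \<alpha> z0)))"
    by (simp only: arctan_le_iff)
  also have "\<dots> = pi / 2 - arctan (Im (F \<alpha> z0) / Re (F \<alpha> z0))"
    using arctan_inverse[of "Im (F \<alpha> z0) / Re (F \<alpha> z0)"] Fz0 by simp
  also have "arctan (Im (F \<alpha> z0) / Re (F \<alpha> z0)) = pi * d / 2"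
    using th(3) arg_conv_arctan[OF Fz0(1)] by (simp add: z0_def)
  finally have "pi * d / 2 + arctan ((1 - \<alpha>) * d) \<le> pi / 2" by simp
  from le_sector_bound[OF assms this] show ?thesis by (simp add: d_def)
qed

section \<open>Squeezing and linearization\<close>

text \<open>The derivative of exp (2 a s) |w|^2 is 2 exp (2 a s) (a - Re c) |w|^2, which is never
  positive; squaring avoids the singularity of the norm at 0. It is used with c = p along the
  semigroup, and with a = 0 and c = \<zeta> p in complex time directions.\<close>

lemma norm_decay:
  fixes w c :: "real \<Rightarrow> complex"
  assumes der: "\<And>s. s \<in> {0..T} \<Longrightarrow> (w has_vector_derivative - (w s * c s)) (at s within {0..T})"
    and c: "\<And>s. s \<in> {0..T} \<Longrightarrow> a \<le> Re (c s)" and "0 \<le> T"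
  shows "norm (w T) \<le> exp (- a * T) * norm (w 0)"
proof -
  let ?u = "\<lambda>s. exp (2 * a * s) * ((Re (w s))\<^sup>2 + (Im (w s))\<^sup>2)"
  have gen: "((\<lambda>s. exp (2 * a * s) * ((X s)\<^sup>2 + (Y s)\<^sup>2)) has_real_derivative
      exp (2 * a * s) * (2 * a * ((X s)\<^sup>2 + (Y s)\<^sup>2) + 2 * (X s * x' + Y s * y'))) (at s)"
    if "(X has_real_derivative x') (at s)" "(Y has_real_derivative y') (at s)" for X Y x' y' s
    using that by (auto intro!: derivative_eq_intros simp: algebra_simps)
  have "?u T \<le> ?u 0"
  proof (rule DERIV_nonpos_imp_decreasing_open[where f = ?u])
    have "continuous_on {0..T} w"
      using der by (rule continuous_on_vector_derivative)
    then show "continuous_on {0..T} ?u" by (intro continuous_intros)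
    fix s assume s: "0 < s" "s < T"
    let ?w' = "- (w s * c s)"
    have w: "(w has_vector_derivative ?w') (at s)"
      using der[of s] s by (simp add: at_within_interior[of s "{0..T}"])
    have Re: "((\<lambda>s. Re (w s)) has_real_derivative Re ?w') (at s)"
      using bounded_linear.has_vector_derivative[OF bounded_linear_Re w]
      by (simp only: has_real_derivative_iff_has_vector_derivative)
    have Im: "((\<lambda>s. Im (w s)) has_real_derivative Im ?w') (at s)"
      using bounded_linear.has_vector_derivative[OF bounded_linear_Im w]
      by (simp only: has_real_derivative_iff_has_vector_derivative)
    have d1: "(?u has_real_derivative 2 * exp (2 * a * s) * ((a - Re (c s)) * (norm (w s))\<^sup>2)) (at s)"
      unfolding cmod_power2
      by (rule DERIV_cong[OF gen[OF Re Im]]) (simp add: power2_eq_square algebra_simps)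
    have d2: "(a - Re (c s)) * (norm (w s))\<^sup>2 \<le> 0"
      using c[of s] s by (intro mult_nonpos_nonneg) auto
    show "\<exists>y. DERIV ?u s :> y \<and> y \<le> 0"
      by (intro exI conjI, rule d1, rule mult_nonneg_nonpos[OF _ d2]) simp
  qed (use assms in auto)
  then have "exp (2 * a * T) * (norm (w T))\<^sup>2 \<le> (norm (w 0))\<^sup>2"
    by (simp add: cmod_power2)
  moreover have "exp (2 * a * T) = (exp (a * T))\<^sup>2"
    by (simp add: power2_eq_square flip: exp_add)
  ultimately have "(exp (a * T) * norm (w T))\<^sup>2 \<le> (norm (w 0))\<^sup>2"
    by (simp add: power_mult_distrib)
  then have "exp (a * T) * norm (w T) \<le> norm (w 0)"
    by (rule power2_le_imp_le) simp
  then show ?thesis by (simp add: exp_minus field_simps)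
qed

lemma semigroup_generated_byD:
  assumes "semigroup_generated_by f \<phi>" "z \<in> \<bbbD>"
  shows "\<phi> 0 z = z" "t \<ge> 0 \<Longrightarrow> \<phi> t z \<in> \<bbbD>"
    "t \<ge> 0 \<Longrightarrow> ((\<lambda>s. \<phi> s z) has_vector_derivative - f (\<phi> t z)) (at t within {0..})"
  using assms by (auto simp: semigroup_generated_by_def)

lemma exponentially_squeezingI:
  assumes "semigroup_generated_by f \<phi>" "0 < a"
    and "\<And>z. z \<in> \<bbbD> \<Longrightarrow> f z = z * p z" "\<And>z. z \<in> \<bbbD> \<Longrightarrow> a \<le> Re (p z)"
  shows "exponentially_squeezing \<phi> a"
  unfolding exponentially_squeezing_def
proof (intro conjI ballI allI impI)
  fix z and t :: real assume z: "z \<in> \<bbbD>" and t: "t \<ge> 0"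
  note D = semigroup_generated_byD[OF assms(1) z]
  have "norm (\<phi> t z) \<le> exp (- a * t) * norm (\<phi> 0 z)"
  proof (rule norm_decay[of t "\<lambda>s. \<phi> s z" "\<lambda>s. p (\<phi> s z)"])
    fix s assume s: "s \<in> {0..t}"
    then show "a \<le> Re (p (\<phi> s z))" using D(2)[of s] by (intro assms(4)) auto
    have "((\<lambda>s. \<phi> s z) has_vector_derivative - f (\<phi> s z)) (at s within {0..t})"
      using D(3)[of s] s by (auto intro: has_vector_derivative_within_subset)
    then show "((\<lambda>s. \<phi> s z) has_vector_derivative - (\<phi> s z * p (\<phi> s z))) (at s within {0..t})"
      using assms(3)[of "\<phi> s z"] D(2)[of s] s by simp
  qed (rule t)
  then show "norm (\<phi> t z) \<le> exp (- a * t) * norm z" by (simp add: D)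
qed (rule assms(2))

text \<open>A finite angular derivative forces \<open>\<phi> t z\<close> to tend to \<zeta> inside a
  Stolz region, but squeezing keeps its modulus at most exp (- a t) < 1.\<close>

lemma exponentially_squeezing_no_repelling_fixed_point:
  assumes "exponentially_squeezing \<phi> a"
  shows "\<not> repelling_fixed_point \<phi> \<zeta>"
proof
  assume "repelling_fixed_point \<phi> \<zeta>"
  then obtain t L where \<zeta>: "norm \<zeta> = 1" and t: "t > 0" and "has_angular_derivative (\<phi> t) L \<zeta>"
    by (auto simp: repelling_fixed_point_def)
  then have lim: "((\<lambda>z. (\<phi> t z - \<zeta>) / (z - \<zeta>)) \<longlongrightarrow> L) (at \<zeta> within stolz_region \<zeta> 2)"
    by (simp add: has_angular_derivative_def has_angular_limit_def)
  let ?F = "at \<zeta> within stolz_region \<zeta> 2"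
  \<comment> \<open>Without this the limit would hold vacuously. The radial points (1 - h) \<zeta>
    lie in the region, as both their distance to \<zeta> and their distance to the circle equal
    h.\<close>
  have "\<zeta> islimpt stolz_region \<zeta> 2"
    unfolding islimpt_approachable
  proof (intro allI impI)
    fix e :: real assume "e > 0"
    define h where "h = min (e / 2) (1 / 2)"
    have h: "0 < h" "h < e" "h < 1" using \<open>e > 0\<close> by (auto simp: h_def min_def)
    have n: "norm (of_real (1 - h) * \<zeta>) = 1 - h"
      unfolding norm_mult norm_of_real \<zeta> using h by simp
    have "of_real (1 - h) * \<zeta> - \<zeta> = - (of_real h * \<zeta>)" by (simp add: algebra_simps)
    then have n': "norm (of_real (1 - h) * \<zeta> - \<zeta>) = h"
      using h \<zeta> by (simp only: norm_minus_cancel norm_mult norm_of_real)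
    have "of_real (1 - h) * \<zeta> \<in> stolz_region \<zeta> 2"
      unfolding stolz_region_def mem_Collect_eq n n' mem_ball_0 using h by simp
    moreover have "of_real (1 - h) * \<zeta> \<noteq> \<zeta>" using n' h by auto
    moreover have "dist (of_real (1 - h) * \<zeta>) \<zeta> < e" using n' h by (simp only: dist_norm)
    ultimately show "\<exists>x'\<in>stolz_region \<zeta> 2. x' \<noteq> \<zeta> \<and> dist x' \<zeta> < e" by blast
  qed
  then have nontrivial: "?F \<noteq> bot" by (simp add: trivial_limit_within)
  have "((\<lambda>z. (\<phi> t z - \<zeta>) / (z - \<zeta>) * (z - \<zeta>)) \<longlongrightarrow> L * (\<zeta> - \<zeta>)) ?F"
    by (intro tendsto_intros lim)
  then have "((\<lambda>z. norm ((\<phi> t z - \<zeta>) / (z - \<zeta>) * (z - \<zeta>))) \<longlongrightarrow> 0) ?F"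
    using tendsto_norm_zero by force
  moreover have "\<forall>\<^sub>F z in ?F. 1 - exp (- a * t) \<le> norm ((\<phi> t z - \<zeta>) / (z - \<zeta>) * (z - \<zeta>))"
    unfolding eventually_at_filter
  proof (intro always_eventually allI impI)
    fix z assume z: "z \<noteq> \<zeta>" "z \<in> stolz_region \<zeta> 2"
    then have "z \<in> \<bbbD>" by (simp add: stolz_region_def)
    then have "norm (\<phi> t z) \<le> exp (- a * t) * norm z"
      using assms t by (simp add: exponentially_squeezing_def)
    also have "\<dots> \<le> exp (- a * t) * 1"
      using \<open>z \<in> \<bbbD>\<close> by (intro mult_left_mono) auto
    finally have "1 - exp (- a * t) \<le> norm \<zeta> - norm (\<phi> t z)" using \<zeta> by simp
    also have "\<dots> \<le> norm (\<phi> t z - \<zeta>)"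
      using norm_triangle_ineq2[of \<zeta> "\<phi> t z"] by (simp add: norm_minus_commute)
    finally show "1 - exp (- a * t) \<le> norm ((\<phi> t z - \<zeta>) / (z - \<zeta>) * (z - \<zeta>))"
      using z by simp
  qed
  ultimately have "1 - exp (- a * t) \<le> 0"
    using nontrivial by (intro tendsto_lowerbound)
  moreover have "a * t > 0" using assms t by (simp add: exponentially_squeezing_def)
  ultimately show False by simp
qed

section \<open>The linearizing (Koenigs) function\<close>

text \<open>The equation reads h' / h = 1 / (z p). Splitting off 1 / z leaves (1 / p - 1) / z, which
  is regular at 0 because \<open>p 0 = 1\<close>; with a primitive \<open>k\<close> of it, h = z exp
  k and h' = exp k / p.\<close>

lemma koenigs_function_exists:
  assumes "p holomorphic_on \<bbbD>" "p 0 = 1" "\<And>z. z \<in> \<bbbD> \<Longrightarrow> p z \<noteq> 0"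
  obtains h where "h holomorphic_on \<bbbD>"
    "\<And>z. z \<in> \<bbbD> \<Longrightarrow> deriv h z \<noteq> 0" "\<And>z. z \<in> \<bbbD> \<Longrightarrow> deriv h z * (z * p z) = h z"
proof -
  define g where "g = (\<lambda>z. 1 / p z - 1)"
  define m where "m = (\<lambda>z. if z = 0 then deriv g 0 else g z / z)"
  have "m holomorphic_on \<bbbD>"
  proof (rule pole_theorem_open_0)
    show "g holomorphic_on \<bbbD>" unfolding g_def using assms by (intro holomorphic_intros) auto
    show "g z = (z - 0) * m z" if "z \<in> \<bbbD> - {0}" for z using that by (simp add: m_def)
    show "m 0 = deriv g 0" "g 0 = 0" by (simp_all add: m_def g_def assms)
  qed auto
  then obtain k where k: "\<And>x. x \<in> \<bbbD> \<Longrightarrow> (k has_field_derivative m x) (at x within \<bbbD>)"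
    using holomorphic_convex_primitive'[of "\<bbbD>" m] by (auto simp: convex_ball)
  have zm: "1 + z * m z = 1 / p z" for z by (simp add: m_def g_def assms)
  define h where "h = (\<lambda>z. z * exp (k z))"
  have der: "(h has_field_derivative exp (k z) / p z) (at z)" if "z \<in> \<bbbD>" for z
  proof -
    have "(k has_field_derivative m z) (at z)"
      using k[OF that] that by (simp add: at_within_open[of _ "\<bbbD>"])
    then have "(h has_field_derivative exp (k z) * (1 + z * m z)) (at z)"
      unfolding h_def by (auto intro!: derivative_eq_intros simp: algebra_simps)
    then show ?thesis by (simp only: zm times_divide_eq_right mult_1_right)
  qed
  show ?thesis
  proof (rule that)
    show "h holomorphic_on \<bbbD>" unfolding holomorphic_on_open[OF open_ball] using der by blast
    show "deriv h z \<noteq> 0" "deriv h z * (z * p z) = h z" if "z \<in> \<bbbD>" for z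
      using DERIV_imp_deriv[OF der[OF that]] assms(3)[OF that] by (auto simp: h_def)
  qed
qed

text \<open>Since h' f = h, the function u(s) = h (\<phi> s z) satisfies u' = - u, so exp s times u
  is constant.\<close>

lemma koenigs_along_semigroup:
  assumes "semigroup_generated_by f \<phi>" "h holomorphic_on \<bbbD>"
    and "\<And>z. z \<in> \<bbbD> \<Longrightarrow> deriv h z * f z = h z" "z \<in> \<bbbD>" "t \<ge> 0"
  shows "h (\<phi> t z) = exp (- of_real t) * h z"
proof -
  note D = semigroup_generated_byD[OF assms(1,4)]
  have "\<exists>c. \<forall>s\<in>{0..}. exp (of_real s) * h (\<phi> s z) = c"
  proof (rule has_derivative_zero_constant)
    fix s :: real assume s: "s \<in> {0..}"
    have "(h has_field_derivative deriv h (\<phi> s z)) (at (\<phi> s z) within (\<lambda>s. \<phi> s z) ` {0..})"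
      by (rule has_field_derivative_at_within[OF holomorphic_derivI[OF assms(2) open_ball]])
         (use D(2)[of s] s in simp)
    moreover have "((\<lambda>s. \<phi> s z) has_vector_derivative - f (\<phi> s z)) (at s within {0..})"
      using D(3)[of s] s by simp
    ultimately
    have "((\<lambda>s. h (\<phi> s z)) has_vector_derivative - f (\<phi> s z) * deriv h (\<phi> s z)) (at s within {0..})"
      using field_vector_diff_chain_within[of "\<lambda>s. \<phi> s z" "- f (\<phi> s z)" s "{0..}" h "deriv h (\<phi> s z)"]
      by (simp add: o_def)
    moreover have "- f (\<phi> s z) * deriv h (\<phi> s z) = - h (\<phi> s z)"
      using assms(3)[of "\<phi> s z"] D(2)[of s] s by (simp add: mult.commute)
    ultimately have hd: "((\<lambda>s. h (\<phi> s z)) has_vector_derivative - h (\<phi> s z)) (at s within {0..})" by simp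
    have "((\<lambda>s. complex_of_real (exp s)) has_vector_derivative of_real (exp s)) (at s within {0..})"
      by (intro has_vector_derivative_of_real DERIV_exp[THEN has_field_derivative_at_within])
    from has_vector_derivative_mult[OF this hd]
    show "((\<lambda>s. exp (of_real s) * h (\<phi> s z)) has_derivative (\<lambda>x. 0)) (at s within {0..})"
      by (simp add: has_vector_derivative_def exp_of_real)
  qed auto
  then have "exp (of_real t) * h (\<phi> t z) = exp (of_real 0) * h (\<phi> 0 z)"
    using assms(5) by (metis atLeast_iff order_refl)
  then show ?thesis by (simp add: D exp_minus field_simps)
qed

text \<open>Points with equal \<open>h\<close> keep equal \<open>h\<close> along their trajectories.
  Squeezing brings both near 0, where \<open>h\<close> is injective, so the trajectories meet. At
  the first meeting time local injectivity of \<open>h\<close> makes them agree slightly earlier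
  too, unless that time is 0.\<close>

lemma koenigs_inj_on:
  assumes sg: "semigroup_generated_by f \<phi>" and h: "h holomorphic_on \<bbbD>"
    and hf: "\<And>z. z \<in> \<bbbD> \<Longrightarrow> deriv h z * f z = h z" and h': "\<And>z. z \<in> \<bbbD> \<Longrightarrow> deriv h z \<noteq> 0"
    and sq: "exponentially_squeezing \<phi> a"
  shows "inj_on h \<bbbD>"
proof (rule inj_onI)
  fix z1 z2 assume z: "z1 \<in> \<bbbD>" "z2 \<in> \<bbbD>" and eq: "h z1 = h z2"
  note D1 = semigroup_generated_byD[OF sg z(1)] and D2 = semigroup_generated_byD[OF sg z(2)]
  have heq: "h (\<phi> t z1) = h (\<phi> t z2)" if "t \<ge> 0" for t
    using koenigs_along_semigroup[OF sg h hf] z that eq by simp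
  have c: "continuous_on {0..} (\<lambda>s. \<phi> s z1)" "continuous_on {0..} (\<lambda>s. \<phi> s z2)"
    using D1(3) D2(3) by (auto intro!: continuous_on_vector_derivative)
  define E where "E = {t \<in> {0..}. \<phi> t z1 = \<phi> t z2}"
  have "closed E"
    unfolding E_def
    using continuous_closed_preimage_constant[OF continuous_on_diff[OF c] closed_atLeast, of 0] by simp
  have "E \<noteq> {}"
  proof -
    obtain r where r: "r > 0" "inj_on h (ball 0 r)"
      using has_complex_derivative_locally_injective[OF h, of 0] h'[of 0] by auto
    have a: "a > 0" using sq by (simp add: exponentially_squeezing_def)
    \<comment> \<open>Chosen so that exp (- a t) \<le> r exp (- a) < r; \<open>max\<close> keeps the
      time nonnegative.\<close>
    define t where "t = max 0 (1 - ln r / a)"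
    have "- a * t \<le> - a * (1 - ln r / a)" using a by (intro mult_left_mono_neg) (auto simp: t_def)
    also have "\<dots> = ln r - a" using a by (simp add: field_simps)
    also have "\<dots> < ln r" using a by simp
    finally have "exp (- a * t) < exp (ln r)" by simp
    then have t: "exp (- a * t) < r" "t \<ge> 0" using r(1) by (simp_all add: t_def)
    have small: "\<phi> t z \<in> ball 0 r" if "z \<in> \<bbbD>" for z
    proof -
      have "norm (\<phi> t z) \<le> exp (- a * t) * norm z" using sq that t by (simp add: exponentially_squeezing_def)
      also have "\<dots> \<le> exp (- a * t) * 1" using that by (intro mult_left_mono) auto
      finally show ?thesis using t by simp
    qed
    have "\<phi> t z1 = \<phi> t z2"
      using inj_onD[OF r(2) heq[OF t(2)]] small z by blast
    then show ?thesis using t by (auto simp: E_def)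
  qed
  define t0 where "t0 = Inf E"
  have bdd: "bdd_below E" by (auto simp: E_def intro: bdd_belowI[of _ 0])
  have t0: "t0 \<in> E" unfolding t0_def using \<open>E \<noteq> {}\<close> bdd \<open>closed E\<close> by (rule closed_contains_Inf)
  then have t0': "t0 \<ge> 0" "\<phi> t0 z1 = \<phi> t0 z2" by (auto simp: E_def)
  have "t0 = 0"
  proof (rule ccontr)
    assume "t0 \<noteq> 0"
    then have pos: "t0 > 0" using t0' by simp
    define w0 where "w0 = \<phi> t0 z1"
    have w0: "w0 \<in> \<bbbD>" unfolding w0_def using D1(2)[OF t0'(1)] .
    obtain r where r: "r > 0" "inj_on h (ball w0 r)"
      using has_complex_derivative_locally_injective[OF h w0 open_ball h'[OF w0]] by blast
    obtain e1 where e1: "e1 > 0" "\<And>s. s \<ge> 0 \<Longrightarrow> dist s t0 < e1 \<Longrightarrow> dist (\<phi> s z1) w0 < r"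
      using c(1) t0'(1) r(1) unfolding continuous_on_iff w0_def by (metis atLeast_iff)
    obtain e2 where e2: "e2 > 0" "\<And>s. s \<ge> 0 \<Longrightarrow> dist s t0 < e2 \<Longrightarrow> dist (\<phi> s z2) w0 < r"
      using c(2) t0' r(1) unfolding continuous_on_iff w0_def by (metis atLeast_iff)
    \<comment> \<open>A step back shorter than \<open>e1\<close> and \<open>e2\<close> that does not
      pass time 0.\<close>
    define s where "s = t0 - min (min e1 e2 / 2) t0"
    have s: "0 \<le> s" "s < t0" "dist s t0 < e1" "dist s t0 < e2"
      using e1 e2 pos by (auto simp: s_def dist_real_def min_def)
    have "\<phi> s z1 = \<phi> s z2"
      using inj_onD[OF r(2) heq[OF s(1)]] e1(2) e2(2) s by (simp add: dist_commute)
    then have "s \<in> E" using s by (simp add: E_def)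
    then have "t0 \<le> s" unfolding t0_def using bdd by (rule cInf_lower)
    then show False using s by simp
  qed
  then show "z1 = z2" using t0'(2) D1(1) D2(1) by simp
qed

section \<open>Analytic extension\<close>

text \<open>Pulled back by the inverse \<open>g\<close>, the curve exp (- \<zeta> s) h z solves w' =
  - \<zeta> w p(w). As Re (\<zeta> p) \<ge> 0, the modulus of w does not increase while the curve
  stays in the image of the disk, so the curve cannot leave that image.\<close>

lemma linearized_flow_stays:
  assumes h: "h holomorphic_on \<bbbD>" and inj: "inj_on h \<bbbD>"
    and h': "\<And>z. z \<in> \<bbbD> \<Longrightarrow> deriv h z \<noteq> 0" and hp: "\<And>z. z \<in> \<bbbD> \<Longrightarrow> deriv h z * (z * p z) = h z"
    and g: "g holomorphic_on (h ` \<bbbD>)" and gh: "\<And>z. z \<in> \<bbbD> \<Longrightarrow> g (h z) = z"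
    and g': "\<And>z. z \<in> \<bbbD> \<Longrightarrow> deriv h z * deriv g (h z) = 1"
    and re: "\<And>w. w \<in> \<bbbD> \<Longrightarrow> 0 \<le> Re (\<zeta> * p w)" and z: "z \<in> \<bbbD>"
  shows "exp (- \<zeta>) * h z \<in> h ` \<bbbD>"
proof -
  define \<gamma> where "\<gamma> = (\<lambda>s::real. exp (- \<zeta> * of_real s) * h z)"
  have opn: "open (h ` \<bbbD>)" using open_mapping_thm3[OF h _ inj] by simp
  have \<gamma>der: "(\<gamma> has_vector_derivative - \<zeta> * \<gamma> s) (at s within S)" for s S
  proof -
    have "((\<lambda>x. exp (- \<zeta> * x) * h z) has_field_derivative - \<zeta> * \<gamma> s) (at (of_real s))"
      unfolding \<gamma>_def by (auto intro!: derivative_eq_intros)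
    from has_vector_derivative_real_field[OF this, of S] show ?thesis by (simp add: \<gamma>_def)
  qed
  have cont: "continuous_on S \<gamma>" for S
    using \<gamma>der by (rule continuous_on_vector_derivative)
  have \<gamma>0: "\<gamma> 0 = h z" by (simp add: \<gamma>_def)
  have bound: "norm (g (\<gamma> T)) \<le> norm z" if "0 \<le> T" and in_range: "\<And>s. s \<in> {0..T} \<Longrightarrow> \<gamma> s \<in> h ` \<bbbD>" for T
  proof -
    have "norm (g (\<gamma> T)) \<le> exp (- 0 * T) * norm (g (\<gamma> 0))"
    proof (rule norm_decay[of T "\<lambda>s. g (\<gamma> s)" "\<lambda>s. \<zeta> * p (g (\<gamma> s))"])
      fix s assume s: "s \<in> {0..T}"
      obtain w where w: "w \<in> \<bbbD>" "\<gamma> s = h w" using in_range[OF s] by blast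
      show "0 \<le> Re (\<zeta> * p (g (\<gamma> s)))" using re[OF w(1)] w gh[OF w(1)] by simp
      have "(g has_field_derivative deriv g (\<gamma> s)) (at (\<gamma> s) within \<gamma> ` {0..T})"
        by (rule has_field_derivative_at_within[OF holomorphic_derivI[OF g opn in_range[OF s]]])
      from field_vector_diff_chain_within[OF \<gamma>der this]
      have "((\<lambda>s. g (\<gamma> s)) has_vector_derivative - \<zeta> * \<gamma> s * deriv g (\<gamma> s)) (at s within {0..T})"
        by (simp add: o_def)
      moreover have "- \<zeta> * \<gamma> s * deriv g (\<gamma> s) = - (g (\<gamma> s) * (\<zeta> * p (g (\<gamma> s))))"
      proof -
        have "\<gamma> s * deriv g (\<gamma> s) = (deriv h w * deriv g (h w)) * (w * p w)"
          unfolding w(2) hp[OF w(1), symmetric] by (simp add: mult_ac)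
        then have "\<gamma> s * deriv g (\<gamma> s) = w * p w" by (simp only: g'[OF w(1)] mult_1_left)
        then have "- \<zeta> * (\<gamma> s * deriv g (\<gamma> s)) = - (w * (\<zeta> * p w))" by simp
        then show ?thesis unfolding w(2) gh[OF w(1)] by (simp only: mult.assoc)
      qed
      ultimately show "((\<lambda>s. g (\<gamma> s)) has_vector_derivative - (g (\<gamma> s) * (\<zeta> * p (g (\<gamma> s))))) (at s within {0..T})"
        by (simp only:)
    qed (rule that(1))
    then show ?thesis by (simp add: \<gamma>0 gh[OF z])
  qed
  text \<open>The first time outside \<open>h ` \<bbbD>\<close> would be a limit of points of the compact set
    \<open>h ` cball 0 (norm z)\<close>.\<close>
  define N where "N = {s \<in> {0..1}. \<gamma> s \<in> - (h ` \<bbbD>)}"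
  have "N = {}"
  proof (rule ccontr)
    assume "N \<noteq> {}"
    have "closed ({0..1} \<inter> \<gamma> -` (- (h ` \<bbbD>)))"
      using opn by (intro continuous_closed_preimage cont closed_atLeastAtMost) (rule closed_Compl)
    moreover have "{0..1} \<inter> \<gamma> -` (- (h ` \<bbbD>)) = N"
      by (auto simp: N_def)
    ultimately have "closed N" by (simp only:)
    moreover have bdd: "bdd_below N" by (auto simp: N_def intro: bdd_belowI[of _ 0])
    ultimately have "Inf N \<in> N" using \<open>N \<noteq> {}\<close> by (intro closed_contains_Inf)
    define \<sigma> where "\<sigma> = Inf N"
    have \<sigma>: "\<sigma> \<in> {0..1}" "\<gamma> \<sigma> \<notin> h ` \<bbbD>" using \<open>Inf N \<in> N\<close> by (auto simp: N_def \<sigma>_def)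
    then have "\<sigma> \<noteq> 0" using \<gamma>0 z by auto
    then have pos: "0 < \<sigma>" using \<sigma> by simp
    have before: "\<gamma> s \<in> h ` \<bbbD>" if "0 \<le> s" "s < \<sigma>" for s
    proof (rule ccontr)
      assume "\<gamma> s \<notin> h ` \<bbbD>"
      then have "s \<in> N" using that \<sigma> by (simp add: N_def)
      then have "\<sigma> \<le> s" unfolding \<sigma>_def using bdd by (rule cInf_lower)
      then show False using that by simp
    qed
    have K: "\<gamma> s \<in> h ` cball 0 (norm z)" if "0 \<le> s" "s < \<sigma>" for s
    proof -
      have "norm (g (\<gamma> s)) \<le> norm z" using that before by (intro bound) auto
      moreover have "\<gamma> s \<in> h ` \<bbbD>" using before[OF that] .
      ultimately show ?thesis using gh by auto
    qed
    have sub: "cball 0 (norm z) \<subseteq> \<bbbD>" using z by auto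
    have "compact (h ` cball 0 (norm z))"
      by (intro compact_continuous_image holomorphic_on_imp_continuous_on holomorphic_on_subset[OF h sub]) auto
    then have cl: "closed (h ` cball 0 (norm z))" by (rule compact_imp_closed)
    have "(\<gamma> \<longlongrightarrow> \<gamma> \<sigma>) (at_left \<sigma>)"
      using cont[of UNIV] by (simp add: continuous_on_eq_continuous_at isCont_def filterlim_at_split)
    moreover have "\<forall>\<^sub>F s in at_left \<sigma>. \<gamma> s \<in> h ` cball 0 (norm z)"
      using eventually_at_left_real[OF pos] by eventually_elim (use K in auto)
    ultimately have "\<gamma> \<sigma> \<in> h ` cball 0 (norm z)"
      by (intro Lim_in_closed_set[OF cl]) auto
    then show False using \<sigma>(2) sub by blast
  qed
  then have "\<gamma> 1 \<in> h ` \<bbbD>" by (force simp: N_def)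
  then show ?thesis by (simp add: \<gamma>_def)
qed

text \<open>Taylor's formula of order one, with u'' bounded by Cauchy's inequality on circles of
  radius r / 2: 2 / (r / 2)^2 = 8 / r^2. The constant involves u only through the bound 1, so the
  difference quotients of a whole family converge uniformly.\<close>

lemma difference_quotient_bound:
  fixes u :: "complex \<Rightarrow> complex"
  assumes "u holomorphic_on ball \<zeta> (2 * r)" "r > 0"
    and bound: "\<And>x. x \<in> ball \<zeta> (2 * r) \<Longrightarrow> norm (u x) \<le> 1"
    and "\<xi> \<in> ball \<zeta> r" "\<xi> \<noteq> \<zeta>"
  shows "norm ((u \<xi> - u \<zeta>) / (\<xi> - \<zeta>) - deriv u \<zeta>) \<le> 8 / r\<^sup>2 * norm (\<xi> - \<zeta>)"
proof -
  let ?f = "\<lambda>i. (deriv ^^ i) u"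
  have "norm (?f 0 \<xi> - (\<Sum>i\<le>1. ?f i \<zeta> * (\<xi> - \<zeta>) ^ i / fact i)) \<le> 8 / r\<^sup>2 * norm (\<xi> - \<zeta>) ^ Suc 1 / fact 1"
  proof (rule complex_Taylor[of "ball \<zeta> r"])
    fix i x assume x: "x \<in> ball \<zeta> r"
    then have x2: "x \<in> ball \<zeta> (2 * r)" using assms(2) by auto
    have "(?f i has_field_derivative deriv (?f i) x) (at x)"
      using holomorphic_derivI[OF holomorphic_higher_deriv[OF assms(1) open_ball] open_ball x2] .
    then show "(?f i has_field_derivative ?f (Suc i) x) (at x within ball \<zeta> r)"
      by (simp add: has_field_derivative_at_within)
  next
    fix x assume x: "x \<in> ball \<zeta> r"
    have sub: "cball x (r / 2) \<subseteq> ball \<zeta> (2 * r)"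
    proof
      fix y assume "y \<in> cball x (r / 2)"
      then have "dist \<zeta> y \<le> dist \<zeta> x + r / 2" using dist_triangle[of \<zeta> y x] by simp
      then show "y \<in> ball \<zeta> (2 * r)" using x assms(2) by simp
    qed
    have "norm ((deriv ^^ 2) u x) \<le> fact 2 * 1 / (r / 2) ^ 2"
    proof (rule Cauchy_inequality)
      show "u holomorphic_on ball x (r / 2)"
        using sub ball_subset_cball by (intro holomorphic_on_subset[OF assms(1)]) blast
      show "continuous_on (cball x (r / 2)) u"
        by (intro holomorphic_on_imp_continuous_on holomorphic_on_subset[OF assms(1) sub])
      show "norm (u y) \<le> 1" if "norm (x - y) = r / 2" for y
        using sub that by (intro bound) (auto simp: dist_norm)
    qed (use assms(2) in auto)
    also have "fact 2 * 1 / (r / 2) ^ 2 = 8 / r\<^sup>2" by (simp add: power_divide)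
    finally show "norm (?f (Suc 1) x) \<le> 8 / r\<^sup>2" by (simp add: numeral_2_eq_2)
  qed (use assms in auto)
  then have *: "norm (u \<xi> - u \<zeta> - deriv u \<zeta> * (\<xi> - \<zeta>)) \<le> 8 / r\<^sup>2 * norm (\<xi> - \<zeta>) * norm (\<xi> - \<zeta>)"
    by (simp add: algebra_simps power2_eq_square)
  have "(u \<xi> - u \<zeta>) / (\<xi> - \<zeta>) - deriv u \<zeta> = (u \<xi> - u \<zeta> - deriv u \<zeta> * (\<xi> - \<zeta>)) / (\<xi> - \<zeta>)"
    using assms(5) by (simp add: diff_divide_distrib)
  then have "norm ((u \<xi> - u \<zeta>) / (\<xi> - \<zeta>) - deriv u \<zeta>) = norm (u \<xi> - u \<zeta> - deriv u \<zeta> * (\<xi> - \<zeta>)) / norm (\<xi> - \<zeta>)"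
    by (simp only: norm_divide)
  also have "\<dots> \<le> 8 / r\<^sup>2 * norm (\<xi> - \<zeta>)"
    using * assms(5) by (subst pos_divide_le_eq) auto
  finally show ?thesis .
qed

text \<open>For \<theta> \<le> pi / 2 the sector avoids the closed negative axis, off which
  \<open>Arg\<close> is continuous.\<close>

lemma open_sector:
  assumes "\<theta> \<le> pi / 2"
  shows "open (\<Lambda> \<theta>)"
proof -
  have sub: "\<Lambda> \<theta> \<subseteq> - \<real>\<^sub>\<le>\<^sub>0"
  proof
    fix \<zeta> assume \<zeta>: "\<zeta> \<in> \<Lambda> \<theta>"
    show "\<zeta> \<in> - \<real>\<^sub>\<le>\<^sub>0"
    proof
      assume "\<zeta> \<in> \<real>\<^sub>\<le>\<^sub>0"
      then have "Re \<zeta> \<le> 0" "Im \<zeta> = 0" by (auto simp: complex_nonpos_Reals_iff)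
      moreover have "Re \<zeta> \<noteq> 0" using \<zeta> \<open>Im \<zeta> = 0\<close> by (auto simp: sector_def complex_eq_iff)
      ultimately have "Arg \<zeta> = pi" by (simp add: Arg_eq_pi)
      then show False using \<zeta> assms pi_gt_zero by (simp add: sector_def)
    qed
  qed
  have "continuous_on (- \<real>\<^sub>\<le>\<^sub>0) (\<lambda>x. \<bar>Arg x\<bar>)"
    by (intro continuous_intros continuous_at_imp_continuous_on ballI continuous_at_Arg) auto
  from continuous_open_preimage[OF this _ open_lessThan[of \<theta>]]
  have "open ((- \<real>\<^sub>\<le>\<^sub>0) \<inter> (\<lambda>x. \<bar>Arg x\<bar>) -` {..<\<theta>})" by (simp add: open_Compl)
  moreover have "(- \<real>\<^sub>\<le>\<^sub>0) \<inter> (\<lambda>x. \<bar>Arg x\<bar>) -` {..<\<theta>} = \<Lambda> \<theta>"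
    using sub by (auto simp: sector_def)
  ultimately show ?thesis by simp
qed

lemma uniform_limit_scaled:
  fixes h :: "complex \<Rightarrow> complex"
  assumes "compact K" "continuous_on K h"
  shows "uniform_limit K (\<lambda>\<xi> z. exp (- \<xi>) * h z) h (at 0 within S)"
proof -
  obtain M where M: "\<And>z. z \<in> K \<Longrightarrow> norm (h z) \<le> M" "M > 0"
    using compact_imp_bounded[OF compact_continuous_image[OF assms(2,1)]]
    unfolding bounded_pos by auto
  show ?thesis
    unfolding uniform_limit_iff
  proof (intro allI impI)
    fix e :: real assume "e > 0"
    have "((\<lambda>\<xi>. exp (- \<xi>) :: complex) \<longlongrightarrow> exp (- 0)) (at 0 within S)"
      by (intro tendsto_intros)
    then have "\<forall>\<^sub>F \<xi> in at 0 within S. dist (exp (- \<xi>) :: complex) (exp (- 0)) < e / M"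
      using \<open>e > 0\<close> M(2) by (intro tendstoD) auto
    then show "\<forall>\<^sub>F \<xi> in at 0 within S. \<forall>z\<in>K. dist (exp (- \<xi>) * h z) (h z) < e"
    proof eventually_elim
      case (elim \<xi>)
      show ?case
      proof
        fix z assume z: "z \<in> K"
        have "dist (exp (- \<xi>) * h z) (h z) = norm ((exp (- \<xi>) - 1) * h z)"
          by (simp add: dist_norm algebra_simps)
        also have "\<dots> \<le> norm (exp (- \<xi>) - 1) * M"
          unfolding norm_mult using M(1)[OF z] by (intro mult_left_mono) auto
        also have "\<dots> < e / M * M"
          using elim M(2) by (intro mult_strict_right_mono) (auto simp: dist_norm)
        finally show "dist (exp (- \<xi>) * h z) (h z) < e" using M(2) by simp
      qed
    qed
  qed
qed

text \<open>In the coordinate \<open>h\<close> the extension is multiplication by exp (- \<zeta>),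
  which yields the semigroup law. Differentiability in \<zeta> is uniform in z because all values of
  \<Phi> lie in the disk; the limit at 0 comes from uniform continuity of \<open>g\<close> on a
  compact neighbourhood of the image of \<open>K\<close>.\<close>

lemma extends_analyticallyI:
  assumes sg: "semigroup_generated_by f \<phi>" and sq: "exponentially_squeezing \<phi> a"
    and p: "p holomorphic_on \<bbbD>" "p 0 = 1" and fp: "\<And>z. z \<in> \<bbbD> \<Longrightarrow> f z = z * p z"
    and \<theta>: "0 < \<theta>" "\<theta> \<le> pi / 2"
    and pos: "\<And>z. z \<in> \<bbbD> \<Longrightarrow> 0 < Re (p z)"
    and re: "\<And>\<zeta> z. \<zeta> \<in> \<Lambda> \<theta> \<Longrightarrow> z \<in> \<bbbD> \<Longrightarrow> 0 \<le> Re (\<zeta> * p z)"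
  shows "extends_analytically \<phi> \<theta>"
proof -
  have pn: "p z \<noteq> 0" if "z \<in> \<bbbD>" for z using pos[OF that] by auto
  obtain h where h: "h holomorphic_on \<bbbD>" "\<And>z. z \<in> \<bbbD> \<Longrightarrow> deriv h z \<noteq> 0"
    "\<And>z. z \<in> \<bbbD> \<Longrightarrow> deriv h z * (z * p z) = h z"
    using koenigs_function_exists[OF p pn] by metis
  have hf: "deriv h z * f z = h z" if "z \<in> \<bbbD>" for z using h(3) fp that by simp
  have inj: "inj_on h \<bbbD>" by (rule koenigs_inj_on[OF sg h(1) hf h(2) sq])
  have opn: "open (h ` \<bbbD>)" using open_mapping_thm3[OF h(1) _ inj] by simp
  obtain g where g: "g holomorphic_on (h ` \<bbbD>)" "\<And>z. z \<in> \<bbbD> \<Longrightarrow> deriv h z * deriv g (h z) = 1"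
    "\<And>z. z \<in> \<bbbD> \<Longrightarrow> g (h z) = z"
    using holomorphic_has_inverse[OF h(1) open_ball inj] by metis
  have stays: "exp (- \<zeta>) * h z \<in> h ` \<bbbD>" if "\<zeta> \<in> \<Lambda> \<theta> \<union> {0}" "z \<in> \<bbbD>" for \<zeta> z
  proof (rule linearized_flow_stays[OF h(1) inj h(2,3) g(1,3,2)])
    show "0 \<le> Re (\<zeta> * p w)" if "w \<in> \<bbbD>" for w using re that \<open>\<zeta> \<in> _\<close> by auto
  qed (use that in auto)
  define \<Phi> where "\<Phi> = (\<lambda>\<zeta> z. g (exp (- \<zeta>) * h z))"
  have h\<Phi>: "h (\<Phi> \<zeta> z) = exp (- \<zeta>) * h z" "\<Phi> \<zeta> z \<in> \<bbbD>" if "\<zeta> \<in> \<Lambda> \<theta> \<union> {0}" "z \<in> \<bbbD>" for \<zeta> z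
    using stays[OF that] g(3) by (auto simp: \<Phi>_def)
  have hol: "\<Phi> \<zeta> holomorphic_on \<bbbD>" if "\<zeta> \<in> \<Lambda> \<theta> \<union> {0}" for \<zeta>
    unfolding \<Phi>_def
    by (rule holomorphic_on_compose_gen[OF _ g(1), unfolded o_def])
       (use stays[OF that] in \<open>auto intro!: holomorphic_intros h(1)\<close>)
  have hol\<zeta>: "(\<lambda>\<zeta>. \<Phi> \<zeta> z) holomorphic_on \<Lambda> \<theta>" if "z \<in> \<bbbD>" for z
    unfolding \<Phi>_def
    by (rule holomorphic_on_compose_gen[OF _ g(1), unfolded o_def])
       (use stays[OF _ that] in \<open>auto intro!: holomorphic_intros\<close>)
  have quotient: "uniform_limit K (\<lambda>\<xi> z. (\<Phi> \<xi> z - \<Phi> \<zeta> z) / (\<xi> - \<zeta>)) (\<lambda>z. deriv (\<lambda>\<zeta>. \<Phi> \<zeta> z) \<zeta>) (at \<zeta>)"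
    if \<zeta>: "\<zeta> \<in> \<Lambda> \<theta>" and K: "K \<subseteq> \<bbbD>" for \<zeta> K
  proof -
    obtain R where R: "R > 0" "ball \<zeta> R \<subseteq> \<Lambda> \<theta>"
      using open_sector[OF \<theta>(2)] \<zeta> openE by blast
    define r where "r = R / 2"
    have r: "r > 0" "ball \<zeta> (2 * r) \<subseteq> \<Lambda> \<theta>" using R by (auto simp: r_def)
    have est: "norm ((\<Phi> \<xi> z - \<Phi> \<zeta> z) / (\<xi> - \<zeta>) - deriv (\<lambda>\<zeta>. \<Phi> \<zeta> z) \<zeta>) \<le> 8 / r\<^sup>2 * norm (\<xi> - \<zeta>)"
      if "z \<in> K" "\<xi> \<in> ball \<zeta> r" "\<xi> \<noteq> \<zeta>" for z \<xi>
    proof (rule difference_quotient_bound[OF _ r(1) _ that(2,3)])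
      have z: "z \<in> \<bbbD>" using that K by blast
      show "(\<lambda>\<zeta>. \<Phi> \<zeta> z) holomorphic_on ball \<zeta> (2 * r)"
        by (rule holomorphic_on_subset[OF hol\<zeta>[OF z] r(2)])
      show "norm (\<Phi> x z) \<le> 1" if "x \<in> ball \<zeta> (2 * r)" for x
        using h\<Phi>(2)[of x z] that r(2) z by auto
    qed
    show ?thesis
      unfolding uniform_limit_iff
    proof (intro allI impI)
      fix e :: real assume "e > 0"
      define d where "d = min r (e * r\<^sup>2 / 8)"
      have d: "d > 0" "d \<le> r" "8 / r\<^sup>2 * d \<le> e"
        using r(1) \<open>e > 0\<close> by (auto simp: d_def min_def field_simps)
      show "\<forall>\<^sub>F \<xi> in at \<zeta>. \<forall>z\<in>K. dist ((\<Phi> \<xi> z - \<Phi> \<zeta> z) / (\<xi> - \<zeta>)) (deriv (\<lambda>\<zeta>. \<Phi> \<zeta> z) \<zeta>) < e"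
        unfolding eventually_at
      proof (intro exI conjI ballI impI)
        show "0 < d" by fact
        fix \<xi> z assume \<xi>: "\<xi> \<noteq> \<zeta> \<and> dist \<xi> \<zeta> < d" and z: "z \<in> K"
        then have "\<xi> \<in> ball \<zeta> r" using d by (simp add: dist_commute)
        have "norm ((\<Phi> \<xi> z - \<Phi> \<zeta> z) / (\<xi> - \<zeta>) - deriv (\<lambda>\<zeta>. \<Phi> \<zeta> z) \<zeta>) \<le> 8 / r\<^sup>2 * norm (\<xi> - \<zeta>)"
          using \<xi> by (intro est z \<open>\<xi> \<in> ball \<zeta> r\<close>) auto
        also have "\<dots> < 8 / r\<^sup>2 * d"
          using \<xi> r(1) by (intro mult_strict_left_mono) (auto simp: dist_norm)
        finally show "dist ((\<Phi> \<xi> z - \<Phi> \<zeta> z) / (\<xi> - \<zeta>)) (deriv (\<lambda>\<zeta>. \<Phi> \<zeta> z) \<zeta>) < e"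
          using d by (simp add: dist_norm)
      qed
    qed
  qed
  have lim0: "uniform_limit K \<Phi> (\<Phi> 0) (at 0 within \<Lambda> \<theta>)" if K: "compact K" "K \<subseteq> \<bbbD>" for K
  proof -
    have conth: "continuous_on K h" using h(1) K by (meson continuous_on_subset holomorphic_on_imp_continuous_on)
    have hK: "compact (h ` K)" using conth K(1) by (rule compact_continuous_image)
    obtain e where e: "e > 0" "(\<Union>x\<in>h ` K. cball x e) \<subseteq> h ` \<bbbD>"
      using compact_subset_open_imp_cball_epsilon_subset[OF hK opn] K by blast
    \<comment> \<open>The closed \<open>e\<close>-neighbourhood of the image of \<open>K\<close>:
      compact as a sum of compact sets, and still inside the image of the disk, where
      \<open>g\<close> is continuous.\<close>
    define B where "B = {x + y | x y. x \<in> h ` K \<and> y \<in> cball 0 e}"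
    have B: "compact B" unfolding B_def using hK by (intro compact_sums) auto
    have inB: "w \<in> B" if "z \<in> K" "dist w (h z) \<le> e" for w z
    proof -
      have "w = h z + (w - h z)" "w - h z \<in> cball 0 e" using that by (auto simp: dist_norm norm_minus_commute)
      then show ?thesis unfolding B_def using that(1) by blast
    qed
    have "B \<subseteq> h ` \<bbbD>"
    proof
      fix w assume "w \<in> B"
      then obtain x y where "w = x + y" "x \<in> h ` K" "y \<in> cball 0 e" by (auto simp: B_def)
      then have "w \<in> cball x e" by (simp add: dist_norm)
      then show "w \<in> h ` \<bbbD>" using e(2) \<open>x \<in> h ` K\<close> by blast
    qed
    then have "continuous_on B g" using g(1) by (meson continuous_on_subset holomorphic_on_imp_continuous_on)
    then have uc: "uniformly_continuous_on B g" using B by (rule compact_uniformly_continuous)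
    have ul: "uniform_limit K (\<lambda>\<xi> z. exp (- \<xi>) * h z) h (at 0 within \<Lambda> \<theta>)"
      by (rule uniform_limit_scaled[OF K(1) conth])
    have "uniform_limit K (\<lambda>\<xi> z. g (exp (- \<xi>) * h z)) (\<lambda>z. g (h z)) (at 0 within \<Lambda> \<theta>)"
    proof (rule uniform_limit_compose_uniformly_continuous_on[OF ul uc])
      show "\<forall>\<^sub>F \<xi> in at 0 within \<Lambda> \<theta>. \<forall>z\<in>K. exp (- \<xi>) * h z \<in> B"
        using uniform_limitD[OF ul e(1)] by eventually_elim (use inB in \<open>auto intro: less_imp_le\<close>)
      show "closed B" using B by (rule compact_imp_closed)
    qed
    then show ?thesis by (simp add: \<Phi>_def)
  qed
  show ?thesis
    unfolding extends_analytically_def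
  proof (intro conjI, rule \<theta>(1), rule \<theta>(2), rule exI[of _ \<Phi>], intro conjI)
    show "\<forall>\<zeta>\<in>\<Lambda> \<theta> \<union> {0}. \<Phi> \<zeta> holomorphic_on \<bbbD> \<and> \<Phi> \<zeta> ` \<bbbD> \<subseteq> \<bbbD>"
      using hol h\<Phi>(2) by (intro ballI conjI image_subsetI)
    show "\<exists>\<Psi>. \<forall>\<zeta>\<in>\<Lambda> \<theta>. \<forall>K. compact K \<and> K \<subseteq> \<bbbD> \<longrightarrow>
        uniform_limit K (\<lambda>\<xi> z. (\<Phi> \<xi> z - \<Phi> \<zeta> z) / (\<xi> - \<zeta>)) (\<Psi> \<zeta>) (at \<zeta>)"
      by (rule exI[of _ "\<lambda>\<zeta> z. deriv (\<lambda>\<zeta>. \<Phi> \<zeta> z) \<zeta>"]) (use quotient in blast)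
    show "\<forall>K. compact K \<and> K \<subseteq> \<bbbD> \<longrightarrow> uniform_limit K \<Phi> (\<Phi> 0) (at 0 within \<Lambda> \<theta>)"
      using lim0 by blast
    show "\<forall>z\<in>\<bbbD>. \<Phi> 0 z = z" using g(3) by (simp add: \<Phi>_def)
    show "\<forall>\<zeta>1\<in>\<Lambda> \<theta> \<union> {0}. \<forall>\<zeta>2\<in>\<Lambda> \<theta> \<union> {0}. \<forall>z\<in>\<bbbD>. \<Phi> (\<zeta>1 + \<zeta>2) z = \<Phi> \<zeta>1 (\<Phi> \<zeta>2 z)"
    proof (intro ballI)
      fix \<zeta>1 \<zeta>2 z assume \<zeta>2: "\<zeta>2 \<in> \<Lambda> \<theta> \<union> {0}" and z: "z \<in> \<bbbD>"
      have "\<Phi> \<zeta>1 (\<Phi> \<zeta>2 z) = g (exp (- \<zeta>1) * h (\<Phi> \<zeta>2 z))" by (simp add: \<Phi>_def)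
      also have "\<dots> = g (exp (- \<zeta>1) * exp (- \<zeta>2) * h z)"
        unfolding h\<Phi>(1)[OF \<zeta>2 z] by (simp only: mult.assoc)
      also have "\<dots> = \<Phi> (\<zeta>1 + \<zeta>2) z"
        by (simp add: \<Phi>_def flip: exp_add)
      finally show "\<Phi> (\<zeta>1 + \<zeta>2) z = \<Phi> \<zeta>1 (\<Phi> \<zeta>2 z)" ..
    qed
    show "\<forall>t\<ge>0. \<forall>z\<in>\<bbbD>. \<Phi> (of_real t) z = \<phi> t z"
    proof (intro allI impI ballI)
      fix t :: real and z assume t: "0 \<le> t" and z: "z \<in> \<bbbD>"
      have "\<Phi> (of_real t) z = g (h (\<phi> t z))"
        using koenigs_along_semigroup[OF sg h(1) hf z t] by (simp add: \<Phi>_def)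
      then show "\<Phi> (of_real t) z = \<phi> t z"
        using g(3)[OF semigroup_generated_byD(2)[OF sg z t]] by simp
    qed
  qed
qed

section \<open>Reduction of the class to the factor p, and conclusion\<close>

text \<open>With f = z p and f' = p + z p' the defining expression of the class becomes p + (1 -
  \<alpha>) z p'. The singularity of f / z at 0 is removable with value f'(0) = 1; at 0, a point
  outside the class condition, the expression is 1.\<close>

lemma filtration_class_factor:
  assumes "f \<in> \<AA> \<alpha>"
  obtains p where "p holomorphic_on \<bbbD>" "p 0 = 1" "\<And>z. z \<in> \<bbbD> \<Longrightarrow> f z = z * p z"
    "\<And>z. z \<in> \<bbbD> \<Longrightarrow> 0 \<le> Re (p z + of_real (1 - \<alpha>) * (z * deriv p z))"
proof -
  have f: "f holomorphic_on \<bbbD>" "f 0 = 0" "deriv f 0 = 1"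
    and re: "\<And>z. z \<in> \<bbbD> \<Longrightarrow> z \<noteq> 0 \<Longrightarrow> 0 \<le> Re (of_real \<alpha> * (f z / z) + of_real (1 - \<alpha>) * deriv f z)"
    using assms by (auto simp: filtration_class_def normalized_holomorphic_def)
  define p where "p = (\<lambda>z. if z = 0 then 1 else f z / z)"
  have fp: "f z = z * p z" for z by (simp add: p_def f)
  have p: "p holomorphic_on \<bbbD>"
    by (rule pole_theorem_open_0[OF f(1) open_ball, of 0]) (simp_all add: p_def f)
  show ?thesis
  proof (rule that[OF p])
    show "p 0 = 1" by (simp add: p_def)
    show "f z = z * p z" for z by (rule fp)
    show "0 \<le> Re (p z + of_real (1 - \<alpha>) * (z * deriv p z))" if z: "z \<in> \<bbbD>" for z
    proof (cases "z = 0")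
      case False
      have "((\<lambda>z. z * p z) has_field_derivative p z + z * deriv p z) (at z)"
        using holomorphic_derivI[OF p open_ball z] by (auto intro!: derivative_eq_intros)
      moreover have "f = (\<lambda>z. z * p z)" using fp by blast
      ultimately have "deriv f z = p z + z * deriv p z" by (metis DERIV_imp_deriv)
      moreover have "f z / z = p z" using False by (simp add: fp)
      ultimately have "of_real \<alpha> * (f z / z) + of_real (1 - \<alpha>) * deriv f z = p z + of_real (1 - \<alpha>) * (z * deriv p z)"
        by (simp add: algebra_simps)
      then show ?thesis using re[OF z False] by simp
    qed (simp add: p_def)
  qed
qed

theorem theorem4p10:
  fixes \<alpha> :: real
    and f :: "complex \<Rightarrow> complex"
    and \<phi> :: "real \<Rightarrow> complex \<Rightarrow> complex"
  assumes "\<alpha> < 1"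
    and "f \<in> \<AA> \<alpha>"
    and "semigroup_generated_by f \<phi>"
  shows "(\<nexists>\<zeta>. repelling_fixed_point \<phi> \<zeta>)
    \<and> exponentially_squeezing \<phi> (\<kappa> \<alpha>)
    \<and> (extends_analytically \<phi> (pi * (1 - \<delta> \<alpha>) / 2) \<and> \<delta> \<alpha> \<le> \<b> \<alpha>)"
proof -
  obtain p where p: "p holomorphic_on \<bbbD>" "p 0 = 1" and fp: "\<And>z. z \<in> \<bbbD> \<Longrightarrow> f z = z * p z"
    and q: "\<And>z. z \<in> \<bbbD> \<Longrightarrow> 0 \<le> Re (p z + of_real (1 - \<alpha>) * (z * deriv p z))"
    using filtration_class_factor[OF assms(2)] by metis
  note transfer = Re_mult_ge_of_F[OF assms(1) p q]
  have ge: "\<kappa> \<alpha> \<le> Re (p z)" if "z \<in> \<bbbD>" for z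
  proof -
    have "\<kappa> \<alpha> \<le> Re (1 * F \<alpha> w)" if "w \<in> \<bbbD>" for w
    proof -
      have "\<kappa> \<alpha> \<le> Re (F \<alpha> w)"
        by (rule Re_F_ge_squeezing_const[OF assms(1)]) (use that in auto)
      then show ?thesis by simp
    qed
    from transfer[OF _ this that] show ?thesis by simp
  qed
  have sq: "exponentially_squeezing \<phi> (\<kappa> \<alpha>)"
    by (rule exponentially_squeezingI[OF assms(3) squeezing_const_pos[OF assms(1)] fp ge])
  have \<delta>: "0 < \<delta> \<alpha>" "\<delta> \<alpha> < 1" using sector_const_attained[OF assms(1)] by metis+
  let ?\<theta> = "pi * (1 - \<delta> \<alpha>) / 2"
  have "extends_analytically \<phi> ?\<theta>"
  proof (rule extends_analyticallyI[OF assms(3) sq p fp])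
    show "0 < ?\<theta>" using \<delta> by simp
    have "pi * (1 - \<delta> \<alpha>) \<le> pi * 1" using \<delta> by (intro mult_left_mono) auto
    then show "?\<theta> \<le> pi / 2" by simp
    show "0 < Re (p z)" if "z \<in> \<bbbD>" for z
      using ge[OF that] squeezing_const_pos[OF assms(1)] by simp
    \<comment> \<open>The sign depends only on the direction of \<zeta>: the half-plane transfer is
      made for \<open>cis (Arg \<zeta>)\<close>, and the modulus is multiplied in
      afterwards.\<close>
    show "0 \<le> Re (\<zeta> * p z)" if \<zeta>: "\<zeta> \<in> \<Lambda> ?\<theta>" and z: "z \<in> \<bbbD>" for \<zeta> z
    proof -
      have "\<bar>Arg \<zeta>\<bar> \<le> ?\<theta>" using \<zeta> by (simp add: sector_def)
      then have "0 \<le> Re (cis (Arg \<zeta>) * F \<alpha> w)" if "w \<in> \<bbbD>" for w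
        using Re_cis_F_nonneg[OF assms(1) that] by blast
      from transfer[OF _ this z] have "0 \<le> Re (cis (Arg \<zeta>) * p z)" by simp
      then have "0 \<le> norm \<zeta> * Re (cis (Arg \<zeta>) * p z)" by (intro mult_nonneg_nonneg) auto
      also have "\<dots> = Re (rcis (norm \<zeta>) (Arg \<zeta>) * p z)"
      proof -
        have "Re (of_real r * x) = r * Re x" for r x by simp
        then show ?thesis by (simp only: rcis_def mult.assoc)
      qed
      finally show ?thesis by (simp only: rcis_cmod_Arg)
    qed
  qed
  then show ?thesis
    using sq exponentially_squeezing_no_repelling_fixed_point[OF sq] sector_const_le_sector_bound[OF assms(1)]
    by blast
qed

end
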